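(* Let $k$ be a field of characteristic zero and $m\geq 3$ an integer. Let $\mathcal{S}$ be the $m\times m$ generic symmetric matrix over $k$, let $\mathcal{SC}$ denote an $\mathcal{MD}$-cloning of $\mathcal{S}$, and let $f=\det(\mathcal{SC})$. Then the dimension of the dual variety of $V(f)$ is $m-1$.
   Context: The generic symmetric matrix $\mathcal{S}$ has $(i,j)$-entry $x_{\min(i,j),\max(i,j)}$, where $x_{i,j}$ ($1\leq i\leq j\leq m$) are indeterminates over $k$. An $\mathcal{MD}$-cloning of $\mathcal{S}$ (cloning along the main diagonal) is the matrix obtained by applying to the entries of $\mathcal{S}$ the $k$-algebra endomorphism that fixes all variables except one diagonal variable, which is mapped to another diagonal variable; up to simultaneous permutation of rows and columns, it is the matrix obtained from $\mathcal{S}$ by replacing $x_{m,m}$ with $x_{m-1,m-1}$. The determinant $f$ is regarded as a form in the polynomial ring $R$ over $k$ generated by the entries of $\mathcal{SC}$ (in $\binom{m+1}{2}-1$ variables), and $V(f)\subset\mathrm{Proj}(R)$ is the hypersurface it defines; its dual variety is the closure, in the dual projective space, of the set of hyperplanes tangent to $V(f)$ at smooth points. Dimension is the dimension as a projective variety. *)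

theory Defs
  imports
    "HOL-Library.Poly_Mapping"
    "HOL-Library.Extended_Nat"
    "HOL-Analysis.Abstract_Topology"
    "HOL-Analysis.Function_Topology"
    "HOL-Algebra.Algebraic_Closure_Type"
    "Jordan_Normal_Form.Determinant"
begin

section \<open>Multivariate polynomials\<close>

text \<open>
  Polynomials with coefficients in \<open>'a\<close> and variables in \<open>'v\<close>, as finitely supported functions
  on the monomials, which are finitely supported exponent vectors.
\<close>

type_synonym ('v, 'a) mpoly = "('v \<Rightarrow>\<^sub>0 nat) \<Rightarrow>\<^sub>0 'a"

definition Var :: "'v \<Rightarrow> ('v, 'a::zero_neq_one) mpoly" where
  "Var v = Poly_Mapping.single (Poly_Mapping.single v 1) 1"

definition Const :: "'a::zero \<Rightarrow> ('v, 'a) mpoly" where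
  "Const c = Poly_Mapping.single 0 c"

definition vars :: "('v, 'a::zero) mpoly \<Rightarrow> 'v set" where
  "vars p = (\<Union>t\<in>Poly_Mapping.keys p. Poly_Mapping.keys t)"

text \<open>
  The extension of the homomorphism \<open>h\<close> on coefficients and the assignment \<open>s\<close> of the
  variables to a homomorphism on polynomials.
\<close>

definition mpoly_hom :: "('a::zero \<Rightarrow> 'b::comm_semiring_1) \<Rightarrow> ('v \<Rightarrow> 'b) \<Rightarrow> ('v, 'a) mpoly \<Rightarrow> 'b" where
  "mpoly_hom h s p =
     (\<Sum>t\<in>Poly_Mapping.keys p. h (Poly_Mapping.lookup p t) *
        (\<Prod>v\<in>Poly_Mapping.keys t. s v ^ Poly_Mapping.lookup t v))"

definition pderiv_var :: "'v \<Rightarrow> ('v, 'a::comm_semiring_1) mpoly \<Rightarrow> ('v, 'a) mpoly" where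
  "pderiv_var v p =
     (\<Sum>t\<in>Poly_Mapping.keys p.
        Poly_Mapping.single (t - Poly_Mapping.single v 1)
          (of_nat (Poly_Mapping.lookup t v) * Poly_Mapping.lookup p t))"

definition forms :: "'v set \<Rightarrow> ('v, 'a::zero) mpoly set" where
  "forms I = {p. vars p \<subseteq> I \<and>
     (\<exists>d. \<forall>t\<in>Poly_Mapping.keys p. (\<Sum>v\<in>Poly_Mapping.keys t. Poly_Mapping.lookup t v) = d)}"


section \<open>Projective varieties over a field\<close>

text \<open>
  A variety in the projective space with coordinates indexed by \<open>I\<close> over the field \<open>'k\<close> is
  represented by its geometric points, i.e. points with coordinates in the algebraic closure of
  \<open>'k\<close>. The closed sets are the zero sets of forms with coefficients in \<open>'k\<close>; identifying points
  that lie in the same closed sets yields the closed points of the scheme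
  \<open>Proj 'k[x\<^sub>v | v \<in> I]\<close>. A point is a line through the origin without the origin.
\<close>

type_synonym ('v, 'k) proj_point = "('v \<Rightarrow> 'k alg_closure) set"

definition proj_space :: "'v set \<Rightarrow> ('v, 'k::field) proj_point set" where
  "proj_space I =
     {{\<lambda>v. c * x v | c. c \<noteq> 0} | x. (\<forall>v. v \<notin> I \<longrightarrow> x v = 0) \<and> (\<exists>v\<in>I. x v \<noteq> 0)}"

abbreviation mpoly_eval ::
  "('v, 'k::field) mpoly \<Rightarrow> ('v \<Rightarrow> 'k alg_closure) \<Rightarrow> 'k alg_closure" where
  "mpoly_eval p x \<equiv> mpoly_hom to_ac x p"

definition hypersurface :: "'v set \<Rightarrow> ('v, 'k::field) mpoly \<Rightarrow> ('v, 'k) proj_point set" where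
  "hypersurface I f = {P \<in> proj_space I. \<forall>x\<in>P. mpoly_eval f x = 0}"

definition zariski :: "'v set \<Rightarrow> ('v, 'k::field) proj_point topology" where
  "zariski I = topology_generated_by
     {proj_space I - hypersurface I (g :: ('v, 'k) mpoly) | g. g \<in> forms I}"

definition irreducible_closed :: "'p topology \<Rightarrow> 'p set \<Rightarrow> bool" where
  "irreducible_closed T Z \<longleftrightarrow> closedin T Z \<and> Z \<noteq> {} \<and>
     (\<forall>A B. closedin T A \<longrightarrow> closedin T B \<longrightarrow> Z \<subseteq> A \<union> B \<longrightarrow> Z \<subseteq> A \<or> Z \<subseteq> B)"

text \<open>The Krull dimension of a nonempty space (the empty space gets the value \<open>0\<close>).\<close>

definition krull_dim :: "'p topology \<Rightarrow> enat" where
  "krull_dim T = Sup {enat n | n. \<exists>Z :: nat \<Rightarrow> 'p set.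
     (\<forall>i\<le>n. irreducible_closed T (Z i)) \<and> (\<forall>i<n. Z i \<subset> Z (Suc i))}"

definition variety_dim :: "'v set \<Rightarrow> ('v, 'k::field) proj_point set \<Rightarrow> enat" where
  "variety_dim I Z = krull_dim (subtopology (zariski I) Z)"


section \<open>The dual variety of a hypersurface\<close>

definition smooth_points :: "'v set \<Rightarrow> ('v, 'k::field) mpoly \<Rightarrow> ('v, 'k) proj_point set" where
  "smooth_points I f =
     {P \<in> hypersurface I f. \<forall>x\<in>P. \<exists>v\<in>I. mpoly_eval (pderiv_var v f) x \<noteq> 0}"

definition tangent_space ::
  "'v set \<Rightarrow> ('v, 'k::field) mpoly \<Rightarrow> ('v, 'k) proj_point \<Rightarrow> ('v, 'k) proj_point set" where
  "tangent_space I f P =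
     {Q \<in> proj_space I. \<forall>x\<in>P. \<forall>y\<in>Q. (\<Sum>v\<in>I. mpoly_eval (pderiv_var v f) x * y v) = 0}"

text \<open>
  The dual projective space is again \<open>proj_space I\<close>: its point \<open>H\<close> stands for the hyperplane
  whose equation has the coordinates of \<open>H\<close> as coefficients.
\<close>

definition hyperplane :: "'v set \<Rightarrow> ('v, 'k::field) proj_point \<Rightarrow> ('v, 'k) proj_point set" where
  "hyperplane I H = {Q \<in> proj_space I. \<forall>a\<in>H. \<forall>y\<in>Q. (\<Sum>v\<in>I. a v * y v) = 0}"

definition dual_variety :: "'v set \<Rightarrow> ('v, 'k::field) mpoly \<Rightarrow> ('v, 'k) proj_point set" where
  "dual_variety I f = Abstract_Topology.closure_of (zariski I)
     {H \<in> proj_space I. \<exists>P\<in>smooth_points I f. tangent_space I f P \<subseteq> hyperplane I H}"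


section \<open>The generic symmetric matrix and its cloning along the main diagonal\<close>

text \<open>Rows and columns are numbered from \<open>0\<close> to \<open>m - 1\<close>.\<close>

definition generic_symmetric :: "nat \<Rightarrow> (nat \<times> nat, 'k::field) mpoly mat" where
  "generic_symmetric m = mat m m (\<lambda>(i, j). Var (min i j, max i j))"

definition md_cloning :: "nat \<Rightarrow> (nat \<times> nat, 'k::field) mpoly mat \<Rightarrow> bool" where
  "md_cloning m A \<longleftrightarrow> (\<exists>p<m. \<exists>q<m. p \<noteq> q \<and>
     A = map_mat (mpoly_hom Const (Var((p, p) := Var (q, q)))) (generic_symmetric m))"

text \<open>
  The variables that generate the polynomial ring \<open>R\<close> of a matrix whose entries are variables.
\<close>

definition entry_vars :: "('v, 'k::field) mpoly mat \<Rightarrow> 'v set" where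
  "entry_vars A = {v. Var v \<in> elements_mat A}"

end

theory Submission
  imports Defs
begin

text \<open>
  Write \<open>x \<mapsto> M(x)\<close> for the linear family of symmetric matrices that is given by the cloning, in
  which the diagonal entries at \<open>p\<close> and \<open>q\<close> agree. The partial derivative of \<open>det M(x)\<close> with respect
  to a variable is the sum of the cofactors at the positions which carry it. If a symmetric matrix
  has a kernel vector \<open>u \<noteq> 0\<close>, its matrix of cofactors is a multiple of \<open>u u\<^sup>T\<close>
  (\<open>cofactor_symmetric_kernel\<close>). Hence the tangent hyperplane at a smooth point has the coordinates
  \<open>\<phi>(u)\<close>, where \<open>\<phi>\<close> is the quadratic map whose component at a variable is the sum of \<open>u\<^sub>i u\<^sub>j\<close> over
  the positions \<open>(i, j)\<close> of that variable (\<open>tangent_space_at_kernel\<close>). Conversely, as \<open>m \<ge> 3\<close>, there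
  is an index \<open>c\<close> other than \<open>p\<close> and \<open>q\<close>, and every \<open>u\<close> with \<open>u\<^sub>c \<noteq> 0\<close> is the kernel of a matrix of
  rank \<open>m - 1\<close> in the family, namely one that agrees with the identity off row and column \<open>c\<close>
  (\<open>star\<close>). Therefore the dual variety is the closure of the image of \<open>\<phi>\<close>.

  It remains to see that this closure has dimension \<open>m - 1\<close>, as the image of a projective space of
  dimension \<open>m - 1\<close> under a finite map should.

  For the lower bound (\<open>variety_dim_closure_ge\<close>), the closures of the images of an increasing chain of
  \<open>m\<close> coordinate subspaces are irreducible, because a form composed with \<open>\<phi>\<close> and restricted to a line
  is a polynomial in one variable, and nonzero polynomials in one variable over an infinite field
  have a common point at which none vanishes. They are distinct because a mixed coordinate
  \<open>2 u\<^sub>p u\<^sub>r\<close> vanishes on one subspace and not on the next.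

  For the upper bound (\<open>variety_dim_closure_le\<close>), a chain of \<open>n + 1\<close> irreducible closed sets yields
  \<open>n + 1\<close> algebraically independent forms on the largest of them: extend the list by a form that
  vanishes on one set and not on the next (\<open>chain_hom_indep\<close>). By density these forms stay independent
  on the image of \<open>\<phi>\<close>. Composed with \<open>\<phi>\<close> they become \<open>n + 1\<close> independent polynomials in \<open>m\<close>
  variables, and comparing the number of monomials in them with the number of monomials in the
  \<open>m\<close> variables gives \<open>n + 1 \<le> m\<close> (\<open>hom_indep_on_image_le\<close>).
\<close>

section \<open>Evaluation and homogeneity of polynomials\<close>

definition monom_val :: "('v \<Rightarrow> 'b::comm_semiring_1) \<Rightarrow> ('v \<Rightarrow>\<^sub>0 nat) \<Rightarrow> 'b" where
  "monom_val s t = (\<Prod>v\<in>Poly_Mapping.keys t. s v ^ Poly_Mapping.lookup t v)"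

text \<open>
  With all weights equal to \<open>1\<close> this is the total degree.
\<close>

definition wt :: "('v \<Rightarrow> nat) \<Rightarrow> ('v \<Rightarrow>\<^sub>0 nat) \<Rightarrow> nat" where
  "wt d t = (\<Sum>v\<in>Poly_Mapping.keys t. Poly_Mapping.lookup t v * d v)"

definition homog :: "'v set \<Rightarrow> nat \<Rightarrow> ('v, 'a::zero) mpoly set" where
  "homog I n = {p. \<forall>t\<in>Poly_Mapping.keys p. Poly_Mapping.keys t \<subseteq> I \<and> wt (\<lambda>_. 1) t = n}"

lemma forms_iff_homog: "p \<in> forms I \<longleftrightarrow> (\<exists>n. p \<in> homog I n)"
  by (auto simp: forms_def homog_def vars_def wt_def)

lemma monom_val_superset:
  "finite A \<Longrightarrow> Poly_Mapping.keys t \<subseteq> A \<Longrightarrow> monom_val s t = (\<Prod>v\<in>A. s v ^ Poly_Mapping.lookup t v)"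
  unfolding monom_val_def by (rule prod.mono_neutral_left) (auto simp: in_keys_iff)

lemma wt_superset:
  "finite A \<Longrightarrow> Poly_Mapping.keys t \<subseteq> A \<Longrightarrow> wt d t = (\<Sum>v\<in>A. Poly_Mapping.lookup t v * d v)"
  unfolding wt_def by (rule sum.mono_neutral_left) (auto simp: in_keys_iff)

lemma monom_val_plus: "monom_val s (t + u) = monom_val s t * monom_val s u"
proof -
  let ?A = "Poly_Mapping.keys t \<union> Poly_Mapping.keys u"
  have "Poly_Mapping.keys (t + u) \<subseteq> ?A" by (rule keys_add)
  then show ?thesis
    by (simp add: monom_val_superset[of ?A] lookup_add power_add prod.distrib)
qed

lemma wt_plus: "wt d (t + u) = wt d t + wt d u"
proof -
  let ?A = "Poly_Mapping.keys t \<union> Poly_Mapping.keys u"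
  have "Poly_Mapping.keys (t + u) \<subseteq> ?A" by (rule keys_add)
  then show ?thesis
    by (simp add: wt_superset[of ?A] lookup_add algebra_simps sum.distrib)
qed

lemma monom_val_0 [simp]: "monom_val s 0 = 1"
  by (simp add: monom_val_def)

lemma wt_0 [simp]: "wt d 0 = 0"
  by (simp add: wt_def)

lemma monom_val_single [simp]: "monom_val s (Poly_Mapping.single v n) = s v ^ n"
  by (simp add: monom_val_def)

lemma wt_single [simp]: "wt d (Poly_Mapping.single v n) = n * d v"
  by (simp add: wt_def)

lemma monom_val_scale: "monom_val (\<lambda>v. c * s v) t = c ^ wt (\<lambda>_. 1) t * monom_val s t"
  by (simp add: monom_val_def wt_def power_mult_distrib prod.distrib power_sum)

lemma lookup_le_wt: "d v \<ge> 1 \<Longrightarrow> Poly_Mapping.lookup t v \<le> wt d t"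
proof (cases "v \<in> Poly_Mapping.keys t")
  case True
  assume "d v \<ge> 1"
  then have "Poly_Mapping.lookup t v \<le> Poly_Mapping.lookup t v * d v" by simp
  also have "\<dots> \<le> wt d t"
    unfolding wt_def by (rule member_le_sum) (use True in auto)
  finally show ?thesis .
qed (simp add: in_keys_iff)

lemma mpoly_hom_altdef:
  "mpoly_hom h s p = (\<Sum>t\<in>Poly_Mapping.keys p. h (Poly_Mapping.lookup p t) * monom_val s t)"
  by (simp add: mpoly_hom_def monom_val_def)

lemma mpoly_sum_monomials:
  "p = (\<Sum>t\<in>Poly_Mapping.keys p. Poly_Mapping.single t (Poly_Mapping.lookup p t))"
  by (rule poly_mapping_eqI) (simp add: lookup_sum lookup_single when_def in_keys_iff)

lemma (in comm_ring_hom) hom_monom_val: "hom (monom_val s t) = monom_val (\<lambda>v. hom (s v)) t"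
  by (simp add: monom_val_def hom_prod hom_power)

text \<open>
  Evaluation is natural in the target ring. This one fact provides the evaluation of a substitution and the evaluation
  of a polynomial that has been restricted to a line.
\<close>

lemma (in comm_ring_hom) hom_mpoly_hom:
  "hom (mpoly_hom g s p) = mpoly_hom (\<lambda>c. hom (g c)) (\<lambda>v. hom (s v)) p"
  by (simp add: mpoly_hom_altdef hom_sum hom_mult hom_monom_val)

context comm_ring_hom
begin

lemma mpoly_hom_single: "mpoly_hom hom s (Poly_Mapping.single t c) = hom c * monom_val s t"
  by (simp add: mpoly_hom_altdef)

lemma mpoly_hom_add: "mpoly_hom hom s (p + q) = mpoly_hom hom s p + mpoly_hom hom s q"
  unfolding mpoly_hom_altdef
  by (rule setsum_keys_plus_distrib) (auto simp: hom_add algebra_simps)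

lemma mpoly_hom_sum: "mpoly_hom hom s (\<Sum>i\<in>A. f i) = (\<Sum>i\<in>A. mpoly_hom hom s (f i))"
  by (induction A rule: infinite_finite_induct) (auto simp: mpoly_hom_add, auto simp: mpoly_hom_def)

lemma mpoly_hom_mult: "mpoly_hom hom s (p * q) = mpoly_hom hom s p * mpoly_hom hom s q"
proof -
  have "p * q = (\<Sum>t\<in>Poly_Mapping.keys p. \<Sum>u\<in>Poly_Mapping.keys q.
      Poly_Mapping.single (t + u) (Poly_Mapping.lookup p t * Poly_Mapping.lookup q u))"
    by (subst mpoly_sum_monomials[of p], subst mpoly_sum_monomials[of q])
       (simp add: sum_product mult_single)
  then have "mpoly_hom hom s (p * q) = (\<Sum>t\<in>Poly_Mapping.keys p. \<Sum>u\<in>Poly_Mapping.keys q.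
      (hom (Poly_Mapping.lookup p t) * hom (Poly_Mapping.lookup q u)) * (monom_val s t * monom_val s u))"
    by (simp only: mpoly_hom_sum mpoly_hom_single hom_mult monom_val_plus)
  then show ?thesis
    by (simp add: mpoly_hom_altdef[of _ _ p] mpoly_hom_altdef[of _ _ q] sum_product algebra_simps)
qed

lemma mpoly_hom_Const: "mpoly_hom hom s (Const c) = hom c"
  by (simp add: Const_def mpoly_hom_single)

lemma mpoly_hom_Var: "mpoly_hom hom s (Var v) = s v"
  by (simp add: Var_def mpoly_hom_single)

lemma comm_ring_hom_mpoly_hom: "comm_ring_hom (mpoly_hom hom s)"
proof
  show "mpoly_hom hom s 1 = 1"
    using mpoly_hom_Const[of s 1] by (simp add: Const_def)
  show "mpoly_hom hom s 0 = 0" by (simp add: mpoly_hom_def)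
qed (auto simp: mpoly_hom_add mpoly_hom_mult)

end

lemma comm_ring_hom_to_ac: "comm_ring_hom (to_ac :: 'k::field \<Rightarrow> _)"
  by standard auto

lemma comm_ring_hom_Const: "comm_ring_hom (Const :: 'k::comm_ring_1 \<Rightarrow> ('v, 'k) mpoly)"
  by standard (auto simp: Const_def single_add mult_single)

interpretation ev: comm_ring_hom "\<lambda>p :: ('v, 'k::field) mpoly. mpoly_eval p x" for x
  by (rule comm_ring_hom.comm_ring_hom_mpoly_hom[OF comm_ring_hom_to_ac])

lemma eval_Const [simp]: "mpoly_eval (Const c) x = to_ac c"
  by (rule comm_ring_hom.mpoly_hom_Const[OF comm_ring_hom_to_ac])

lemma eval_Var [simp]: "mpoly_eval (Var v) x = x v"
  by (rule comm_ring_hom.mpoly_hom_Var[OF comm_ring_hom_to_ac])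

definition subst :: "('v \<Rightarrow> ('w, 'k::comm_ring_1) mpoly) \<Rightarrow> ('v, 'k) mpoly \<Rightarrow> ('w, 'k) mpoly" where
  "subst \<phi> p = mpoly_hom Const \<phi> p"

lemma eval_subst: "mpoly_eval (subst \<phi> p) x = mpoly_eval p (\<lambda>v. mpoly_eval (\<phi> v) x)"
  by (simp add: subst_def ev.hom_mpoly_hom)

lemma homog_0 [simp]: "0 \<in> homog I n"
  by (simp add: homog_def)

lemma homog_add: "p \<in> homog I n \<Longrightarrow> q \<in> homog I n \<Longrightarrow> p + q \<in> homog I n"
  using keys_add[of p q] by (fastforce simp: homog_def)

lemma homog_sum: "(\<And>i. i \<in> A \<Longrightarrow> f i \<in> homog I n) \<Longrightarrow> (\<Sum>i\<in>A. f i) \<in> homog I n"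
  by (induction A rule: infinite_finite_induct) (auto intro: homog_add)

lemma homog_mult:
  assumes "p \<in> homog I n" "q \<in> homog I n'"
  shows "p * q \<in> homog I (n + n')"
proof -
  have "Poly_Mapping.keys t \<subseteq> I \<and> wt (\<lambda>_. 1) t = n + n'"
    if t: "t \<in> Poly_Mapping.keys (p * q)" for t
  proof -
    obtain a b where "t = a + b" "a \<in> Poly_Mapping.keys p" "b \<in> Poly_Mapping.keys q"
      using keys_mult[of p q] t by blast
    then show ?thesis
      using assms keys_add[of a b] by (auto simp: homog_def wt_plus dest!: subsetD)
  qed
  then show ?thesis by (simp add: homog_def)
qed

lemma homog_Const: "Const c \<in> homog I 0"
  by (simp add: homog_def Const_def)

lemma homog_1: "(1 :: ('v, 'k::comm_ring_1) mpoly) \<in> homog I 0"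
  using homog_Const[of "1::'k" I] by (simp add: Const_def)

lemma homog_Var: "v \<in> I \<Longrightarrow> Var v \<in> homog I 1"
  by (auto simp: homog_def Var_def)

lemma homog_prod:
  fixes f :: "'i \<Rightarrow> ('v, 'k::comm_ring_1) mpoly"
  shows "(\<And>i. i \<in> A \<Longrightarrow> f i \<in> homog I (n i)) \<Longrightarrow> prod f A \<in> homog I (sum n A)"
  by (induction A rule: infinite_finite_induct) (auto intro: homog_mult homog_1)

lemma homog_power:
  fixes p :: "('v, 'k::comm_ring_1) mpoly"
  shows "p \<in> homog I n \<Longrightarrow> p ^ k \<in> homog I (k * n)"
  by (induction k) (auto intro: homog_mult homog_1)

lemma homog_monom_val:
  fixes F :: "'i \<Rightarrow> ('v, 'k::comm_ring_1) mpoly"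
  assumes "\<And>i. i \<in> Poly_Mapping.keys t \<Longrightarrow> F i \<in> homog I (d i)"
  shows "monom_val F t \<in> homog I (wt d t)"
  unfolding monom_val_def wt_def by (rule homog_prod) (auto intro: homog_power assms)

lemma homog_subst:
  assumes "p \<in> homog I n" and "\<And>v. v \<in> I \<Longrightarrow> \<phi> v \<in> homog J d"
  shows "subst \<phi> p \<in> homog J (n * d)"
  unfolding subst_def mpoly_hom_altdef
proof (rule homog_sum)
  fix t assume t: "t \<in> Poly_Mapping.keys p"
  have "monom_val \<phi> t \<in> homog J (wt (\<lambda>_. d) t)"
    by (rule homog_monom_val, rule assms(2)) (use assms(1) t in \<open>auto simp: homog_def\<close>)
  moreover have "wt (\<lambda>_. d) t = n * d"
    using assms(1) t by (auto simp: homog_def wt_def simp flip: sum_distrib_right)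
  ultimately show "Const (Poly_Mapping.lookup p t) * monom_val \<phi> t \<in> homog J (n * d)"
    using homog_mult[OF homog_Const[of "Poly_Mapping.lookup p t" J]] by fastforce
qed

text \<open>
  This is why the vanishing of a form at a point does not depend on the representing vector.
\<close>

lemma mpoly_hom_scale:
  assumes "p \<in> homog I n"
  shows "mpoly_hom h (\<lambda>v. c * x v) p = c ^ n * mpoly_hom h x p"
  unfolding mpoly_hom_altdef monom_val_scale sum_distrib_left
  by (rule sum.cong) (use assms in \<open>auto simp: homog_def ac_simps\<close>)

lemma forms_mult:
  fixes g h :: "('v, 'k::comm_ring_1) mpoly"
  shows "g \<in> forms I \<Longrightarrow> h \<in> forms I \<Longrightarrow> g * h \<in> forms I"
  by (auto simp: forms_iff_homog intro: homog_mult)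

section \<open>Points, forms and closed sets\<close>

definition proj_pt :: "('v \<Rightarrow> 'k alg_closure) \<Rightarrow> ('v, 'k::field) proj_point" where
  "proj_pt x = {\<lambda>v. c * x v | c. c \<noteq> 0}"

lemma proj_pt_self: "x \<in> proj_pt x"
  unfolding proj_pt_def by (intro CollectI exI[of _ 1]) auto

lemma proj_pt_scale_subset:
  assumes "a \<noteq> 0" shows "proj_pt (\<lambda>v. a * y v) \<subseteq> proj_pt y"
proof
  fix f assume "f \<in> proj_pt (\<lambda>v. a * y v)"
  then obtain b where "f = (\<lambda>v. b * (a * y v))" "b \<noteq> 0" unfolding proj_pt_def by blast
  then show "f \<in> proj_pt y"
    unfolding proj_pt_def using assms by (intro CollectI exI[of _ "b * a"]) (simp add: mult.assoc)
qed

lemma proj_pt_scale: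
  assumes "c \<noteq> 0" shows "proj_pt (\<lambda>v. c * x v) = proj_pt x"
proof
  have "(\<lambda>v. inverse c * (c * x v)) = x" using assms by (simp flip: mult.assoc)
  then show "proj_pt x \<subseteq> proj_pt (\<lambda>v. c * x v)"
    using proj_pt_scale_subset[of "inverse c" "\<lambda>v. c * x v"] assms by simp
qed (rule proj_pt_scale_subset[OF assms])

lemma proj_pt_mem:
  assumes "x \<in> proj_pt y" shows "proj_pt x = proj_pt y"
proof -
  obtain c where "x = (\<lambda>v. c * y v)" "c \<noteq> 0" using assms unfolding proj_pt_def by blast
  then show ?thesis using proj_pt_scale by blast
qed

lemma proj_pt_in_proj_space:
  "proj_pt x \<in> proj_space I \<longleftrightarrow> (\<forall>v. v \<notin> I \<longrightarrow> x v = 0) \<and> (\<exists>v\<in>I. x v \<noteq> 0)"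
proof
  assume "proj_pt x \<in> proj_space I"
  then obtain y where y: "proj_pt x = proj_pt y" "\<forall>v. v \<notin> I \<longrightarrow> y v = 0" "\<exists>v\<in>I. y v \<noteq> 0"
    by (auto simp: proj_space_def proj_pt_def)
  then have "x \<in> proj_pt y" using proj_pt_self by blast
  then show "(\<forall>v. v \<notin> I \<longrightarrow> x v = 0) \<and> (\<exists>v\<in>I. x v \<noteq> 0)"
    using y by (auto simp: proj_pt_def)
qed (auto simp: proj_space_def proj_pt_def)

lemma proj_space_mem:
  assumes "P \<in> proj_space I" "x \<in> P"
  shows "P = proj_pt x"
proof -
  obtain y where "P = proj_pt y" using assms by (auto simp: proj_space_def proj_pt_def)
  then show ?thesis using assms(2) proj_pt_mem by blast
qed

lemma proj_space_nonempty:
  assumes "P \<in> proj_space I" obtains x where "x \<in> P" "P = proj_pt x"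
proof -
  obtain y where "P = proj_pt y" using assms by (auto simp: proj_space_def proj_pt_def)
  then show ?thesis using that proj_pt_self by blast
qed

lemma mem_hypersurface_iff:
  assumes "g \<in> forms I" "P \<in> proj_space I" "x \<in> P"
  shows "P \<in> hypersurface I g \<longleftrightarrow> mpoly_eval g x = 0"
proof -
  obtain n where n: "g \<in> homog I n" using assms(1) forms_iff_homog by blast
  have "P = proj_pt x" using assms proj_space_mem by blast
  then have "mpoly_eval g y = 0" if "y \<in> P" "mpoly_eval g x = 0" for y
    using that by (auto simp: proj_pt_def mpoly_hom_scale[OF n])
  then show ?thesis using assms by (auto simp: hypersurface_def)
qed

text \<open>
  Consequently the complements of hypersurfaces of forms are closed under finite intersections, so they are a base of
  the Zariski topology and not just a subbase.
\<close>

lemma hypersurface_mult: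
  assumes "g \<in> forms I" "h \<in> forms I"
  shows "hypersurface I (g * h) = hypersurface I g \<union> hypersurface I h"
proof -
  have "P \<in> hypersurface I (g * h) \<longleftrightarrow> P \<in> hypersurface I g \<union> hypersurface I h"
    if P: "P \<in> proj_space I" for P
  proof -
    obtain x where x: "x \<in> P" using P proj_space_nonempty by blast
    show ?thesis
      using assms forms_mult[OF assms] P x by (simp add: mem_hypersurface_iff[of _ _ _ x] ev.hom_mult)
  qed
  then show ?thesis by (auto simp: hypersurface_def)
qed

lemma topspace_zariski [simp]:
  "topspace (zariski I :: ('v, 'k::field) proj_point topology) = proj_space I"
proof -
  have 1: "(Const 1 :: ('v, 'k) mpoly) \<in> forms I"
    using homog_Const forms_iff_homog by blast
  have "hypersurface I (Const 1 :: ('v, 'k) mpoly) = {}"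
    by (auto simp: hypersurface_def elim: proj_space_nonempty)
  then have "proj_space I \<in> {proj_space I - hypersurface I (g :: ('v, 'k) mpoly) | g. g \<in> forms I}"
    using 1 by (intro CollectI exI[of _ "Const 1"]) auto
  then have "proj_space I \<subseteq> topspace (zariski I :: ('v, 'k) proj_point topology)"
    unfolding zariski_def topology_generated_by_topspace by (rule Union_upper)
  moreover have "topspace (zariski I :: ('v, 'k) proj_point topology) \<subseteq> proj_space I"
    unfolding zariski_def topology_generated_by_topspace by (rule Union_least) auto
  ultimately show ?thesis by (rule antisym[rotated])
qed

lemma closedin_hypersurface: "g \<in> forms I \<Longrightarrow> closedin (zariski I) (hypersurface I g)"
  unfolding closedin_def topspace_zariski
  by (auto simp: zariski_def hypersurface_def intro!: topology_generated_by_Basis)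

lemma zariski_open_basis:
  fixes U :: "('v, 'k::field) proj_point set"
  assumes "openin (zariski I) U" "P \<in> U"
  obtains g :: "('v, 'k) mpoly" where "g \<in> forms I" "P \<in> proj_space I" "P \<notin> hypersurface I g"
    "proj_space I - hypersurface I g \<subseteq> U"
proof -
  have "\<exists>g :: ('v, 'k) mpoly. g \<in> forms I \<and> P \<in> proj_space I - hypersurface I g
      \<and> proj_space I - hypersurface I g \<subseteq> U"
    using assms unfolding zariski_def openin_topology_generated_by_iff
  proof (induction U)
    case (Int U V)
    have "P \<in> U" "P \<in> V" using Int.prems by auto
    obtain g :: "('v, 'k) mpoly" where "g \<in> forms I" "P \<in> proj_space I - hypersurface I g"
      "proj_space I - hypersurface I g \<subseteq> U" using Int.IH(1)[OF \<open>P \<in> U\<close>] by blast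
    moreover obtain h :: "('v, 'k) mpoly" where "h \<in> forms I" "P \<in> proj_space I - hypersurface I h"
      "proj_space I - hypersurface I h \<subseteq> V" using Int.IH(2)[OF \<open>P \<in> V\<close>] by blast
    ultimately show ?case
      by (intro exI[of _ "g * h"]) (auto simp: hypersurface_mult forms_mult)
  next
    case (UN K)
    then obtain U where U: "U \<in> K" "P \<in> U" by blast
    then obtain g :: "('v, 'k) mpoly" where
      "g \<in> forms I" "P \<in> proj_space I - hypersurface I g" "proj_space I - hypersurface I g \<subseteq> U"
      using UN.IH[OF U] by blast
    then show ?case using U(1) by (intro exI[of _ g]) auto
  qed auto
  then show thesis using that by blast
qed

lemma zariski_separating_form:
  fixes Z :: "('v, 'k::field) proj_point set"
  assumes "closedin (zariski I) Z" "Q \<in> proj_space I" "Q \<notin> Z"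
  obtains g :: "('v, 'k) mpoly" where "g \<in> forms I" "Z \<subseteq> hypersurface I g" "Q \<notin> hypersurface I g"
proof -
  have "openin (zariski I) (proj_space I - Z)" "Q \<in> proj_space I - Z" "Z \<subseteq> proj_space I"
    using assms closedin_subset[OF assms(1)] by (auto simp: closedin_def)
  then show thesis using that by (elim zariski_open_basis) blast+
qed

abbreviation zariski_closure :: "'v set \<Rightarrow> ('v, 'k::field) proj_point set \<Rightarrow> ('v, 'k) proj_point set" where
  "zariski_closure I S \<equiv> Abstract_Topology.closure_of (zariski I) S"

lemma closure_subset_hypersurface:
  "g \<in> forms I \<Longrightarrow> S \<subseteq> hypersurface I g \<Longrightarrow> zariski_closure I S \<subseteq> hypersurface I g"
  by (rule closure_of_minimal) (auto intro: closedin_hypersurface)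

lemma subset_zariski_closure: "S \<subseteq> proj_space I \<Longrightarrow> S \<subseteq> zariski_closure I S"
  by (rule closure_of_subset) simp

text \<open>
  Irreducibility of a closure can be tested with hypersurfaces of forms on the dense subset, since every point outside
  a closed set is separated from it by a form.
\<close>

lemma irreducible_closure:
  fixes S :: "('v, 'k::field) proj_point set"
  assumes C: "closedin (zariski I) C" and S: "S \<subseteq> C" "S \<noteq> {}"
    and meet: "\<And>g h :: ('v, 'k) mpoly. g \<in> forms I \<Longrightarrow> h \<in> forms I \<Longrightarrow>
      \<not> S \<subseteq> hypersurface I g \<Longrightarrow> \<not> S \<subseteq> hypersurface I h \<Longrightarrow>
      \<not> S \<subseteq> hypersurface I g \<union> hypersurface I h"
  shows "irreducible_closed (subtopology (zariski I) C) (zariski_closure I S)"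
proof -
  let ?S = "zariski_closure I S"
  have sub: "S \<subseteq> proj_space I" using S closedin_subset[OF C] by auto
  have SC: "?S \<subseteq> C" using C S(1) by (rule closure_of_minimal[rotated])
  have closed: "closedin (zariski I) A" if "closedin (subtopology (zariski I) C) A" for A
    using that C closedin_trans_full by blast
  have "?S \<subseteq> A \<or> ?S \<subseteq> B"
    if A: "closedin (zariski I) A" and B: "closedin (zariski I) B" and AB: "?S \<subseteq> A \<union> B" for A B
  proof (rule ccontr)
    assume "\<not> (?S \<subseteq> A \<or> ?S \<subseteq> B)"
    then have "\<not> S \<subseteq> A" "\<not> S \<subseteq> B" using A B closure_of_minimal by metis+
    then obtain P Q where PQ: "P \<in> S" "P \<notin> A" "Q \<in> S" "Q \<notin> B" by blast
    obtain g :: "('v, 'k) mpoly" where g: "g \<in> forms I" "A \<subseteq> hypersurface I g" "P \<notin> hypersurface I g"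
      using zariski_separating_form[OF A] PQ sub by blast
    obtain h :: "('v, 'k) mpoly" where h: "h \<in> forms I" "B \<subseteq> hypersurface I h" "Q \<notin> hypersurface I h"
      using zariski_separating_form[OF B] PQ sub by blast
    have "S \<subseteq> hypersurface I g \<union> hypersurface I h"
      using AB g h subset_zariski_closure[OF sub] by blast
    then show False using meet g h PQ by blast
  qed
  moreover have "closedin (subtopology (zariski I) C) ?S"
    using SC by (simp add: closedin_subset_topspace)
  moreover have "?S \<noteq> {}" using subset_zariski_closure[OF sub] S by blast
  ultimately show ?thesis unfolding irreducible_closed_def using closed by blast
qed

text \<open>
  The vanishing ideal of an irreducible closed set is prime, as far as forms are concerned.
\<close>

lemma irreducible_closed_prime:
  fixes Z C :: "('v, 'k::field) proj_point set"
  assumes C: "closedin (zariski I) C" and Z: "irreducible_closed (subtopology (zariski I) C) Z"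
    and gh: "g \<in> forms I" "h \<in> forms I" and sub: "Z \<subseteq> hypersurface I (g * h)"
  shows "Z \<subseteq> hypersurface I g \<or> Z \<subseteq> hypersurface I h"
proof -
  have "Z \<subseteq> C" using Z closedin_subset unfolding irreducible_closed_def by fastforce
  then have "Z \<subseteq> (C \<inter> hypersurface I g) \<union> (C \<inter> hypersurface I h)"
    using sub by (auto simp: hypersurface_mult[OF gh])
  moreover have "closedin (subtopology (zariski I) C) (C \<inter> hypersurface I f)" if "f \<in> forms I" for f :: "('v, 'k) mpoly"
    using closedin_hypersurface[OF that] by (auto simp: closedin_subtopology)
  ultimately show ?thesis
    using Z gh unfolding irreducible_closed_def by (meson le_inf_iff)
qed

lemma subset_hypersurface_iff:
  assumes "g \<in> forms I" "Z \<subseteq> proj_space I"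
  shows "Z \<subseteq> hypersurface I g \<longleftrightarrow> (\<forall>x\<in>\<Union>Z. mpoly_eval g x = 0)"
  using assms by (auto simp: hypersurface_def)

section \<open>Forms that are independent along a chain of closed sets\<close>

text \<open>
  Algebraic independence over the base field of \<open>F 0, \<dots>, F (r - 1)\<close> as functions on
  \<open>C\<close>, tested only on relations that are homogeneous when the \<open>i\<close>-th unknown has weight
  \<open>d i\<close>, the degree of \<open>F i\<close>. For such a relation the left hand side is again a form, so
  that the primality of the vanishing ideal applies to it.
\<close>

definition hom_indep ::
  "(nat \<Rightarrow> nat) \<Rightarrow> (nat \<Rightarrow> ('v, 'k::field) mpoly) \<Rightarrow> nat \<Rightarrow> ('v \<Rightarrow> 'k alg_closure) set \<Rightarrow> bool" where
  "hom_indep d F r C \<longleftrightarrow> (\<forall>A c w. finite A \<longrightarrow>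
     (\<forall>t\<in>A. Poly_Mapping.keys t \<subseteq> {..<r} \<and> wt d t = w) \<longrightarrow>
     (\<forall>x\<in>C. mpoly_eval (\<Sum>t\<in>A. Const (c t) * monom_val F t) x = 0) \<longrightarrow> (\<forall>t\<in>A. c t = 0))"

lemma monom_val_cong: "(\<And>v. v \<in> Poly_Mapping.keys t \<Longrightarrow> s v = s' v) \<Longrightarrow> monom_val s t = monom_val s' t"
  by (simp add: monom_val_def)

lemma wt_cong: "(\<And>v. v \<in> Poly_Mapping.keys t \<Longrightarrow> d v = d' v) \<Longrightarrow> wt d t = wt d' t"
  by (simp add: wt_def)

lemma hom_indep_cong:
  assumes "hom_indep d F r C" "\<And>i. i < r \<Longrightarrow> d i = d' i" "\<And>i. i < r \<Longrightarrow> F i = F' i"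
  shows "hom_indep d' F' r C"
  unfolding hom_indep_def
proof (intro allI impI)
  fix A c w
  assume A: "finite A" "\<forall>t\<in>A. Poly_Mapping.keys t \<subseteq> {..<r} \<and> wt d' t = w"
    and 0: "\<forall>x\<in>C. mpoly_eval (\<Sum>t\<in>A. Const (c t) * monom_val F' t) x = 0"
  have "monom_val F t = monom_val F' t \<and> wt d t = wt d' t" if "t \<in> A" for t
  proof -
    have keys: "i < r" if "i \<in> Poly_Mapping.keys t" for i using that A(2) \<open>t \<in> A\<close> by auto
    show ?thesis by (intro conjI monom_val_cong wt_cong assms keys)
  qed
  then have "\<forall>t\<in>A. Poly_Mapping.keys t \<subseteq> {..<r} \<and> wt d t = w"
    "\<forall>x\<in>C. mpoly_eval (\<Sum>t\<in>A. Const (c t) * monom_val F t) x = 0"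
    using A 0 by (auto cong: sum.cong)
  then show "\<forall>t\<in>A. c t = 0"
    using assms(1) A(1) unfolding hom_indep_def by blast
qed

lemma hom_indep_mono: "hom_indep d F r C \<Longrightarrow> C \<subseteq> C' \<Longrightarrow> hom_indep d F r C'"
  unfolding hom_indep_def by (meson subsetD)

lemma split_exponent:
  fixes t :: "'v \<Rightarrow>\<^sub>0 nat"
  assumes "e \<le> Poly_Mapping.lookup t v"
  shows "t = (t - Poly_Mapping.single v e) + Poly_Mapping.single v e"
  using assms by (intro poly_mapping_eqI) (auto simp: lookup_add lookup_minus lookup_single when_def)

text \<open>
  Take a nontrivial relation on \<open>C'\<close> and divide it by the largest possible power \<open>(F
  r)\<^sup>e\<close>. Since the vanishing ideal of \<open>C'\<close> is prime and \<open>F r\<close> does not vanish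
  on it, the quotient \<open>Q\<close> is still a relation on \<open>C'\<close>. On the smaller set \<open>C\<close>
  all terms of \<open>Q\<close> that involve \<open>F r\<close> vanish, and what remains is a nontrivial relation
  between the first \<open>r\<close> forms.
\<close>

lemma hom_indep_Suc:
  fixes F :: "nat \<Rightarrow> ('v, 'k::field) mpoly"
  assumes ind: "hom_indep d F r C" and sub: "C \<subseteq> C'"
    and hom: "\<And>i. i \<le> r \<Longrightarrow> F i \<in> homog I (d i)"
    and prime: "\<And>g h :: ('v, 'k) mpoly. g \<in> forms I \<Longrightarrow> h \<in> forms I \<Longrightarrow> (\<forall>x\<in>C'. mpoly_eval (g * h) x = 0) \<Longrightarrow>
      (\<forall>x\<in>C'. mpoly_eval g x = 0) \<or> (\<forall>x\<in>C'. mpoly_eval h x = 0)"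
    and van: "\<forall>x\<in>C. mpoly_eval (F r) x = 0" and nonvan: "\<exists>x\<in>C'. mpoly_eval (F r) x \<noteq> 0"
  shows "hom_indep d F (Suc r) C'"
  unfolding hom_indep_def
proof (intro allI impI, rule ccontr)
  fix A c w
  assume A: "finite A" "\<forall>t\<in>A. Poly_Mapping.keys t \<subseteq> {..<Suc r} \<and> wt d t = w"
    and rel: "\<forall>x\<in>C'. mpoly_eval (\<Sum>t\<in>A. Const (c t) * monom_val F t) x = 0"
    and "\<not> (\<forall>t\<in>A. c t = 0)"
  define A' where "A' = {t\<in>A. c t \<noteq> 0}"
  have A': "finite A'" "A' \<noteq> {}" "A' \<subseteq> A" using A(1) \<open>\<not> (\<forall>t\<in>A. c t = 0)\<close> by (auto simp: A'_def)
  \<comment> \<open>The largest power of \<open>F r\<close> that divides every term of the relation.\<close>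
  define e where "e = Min ((\<lambda>t. Poly_Mapping.lookup t r) ` A')"
  have e_le: "e \<le> Poly_Mapping.lookup t r" if "t \<in> A'" for t
    unfolding e_def using A' that by simp
  have "e \<in> (\<lambda>t. Poly_Mapping.lookup t r) ` A'"
    unfolding e_def using A' by (intro Min_in) auto
  then obtain t0 where t0: "t0 \<in> A'" "Poly_Mapping.lookup t0 r = e" by auto
  define \<tau> where "\<tau> t = t - Poly_Mapping.single r e" for t :: "nat \<Rightarrow>\<^sub>0 nat"
  have \<tau>: "t = \<tau> t + Poly_Mapping.single r e" if "t \<in> A'" for t
    unfolding \<tau>_def by (rule split_exponent[OF e_le[OF that]])
  have lookup_\<tau>: "Poly_Mapping.lookup (\<tau> t) i = Poly_Mapping.lookup t i - (if i = r then e else 0)" for t i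
    by (simp add: \<tau>_def lookup_minus lookup_single when_def)
  have keys_\<tau>: "Poly_Mapping.keys (\<tau> t) \<subseteq> {..r}" if "t \<in> A'" for t
  proof -
    have "Poly_Mapping.keys (\<tau> t) \<subseteq> Poly_Mapping.keys t"
      by (auto simp: in_keys_iff lookup_\<tau>)
    then show ?thesis using that A(2) A'(3) lessThan_Suc_atMost by blast
  qed
  have wt_\<tau>: "wt d (\<tau> t) = w - e * d r" if "t \<in> A'" for t
    using that A(2) A'(3) arg_cong[OF \<tau>[OF that], of "wt d"] by (auto simp: wt_plus)
  define Q where "Q = (\<Sum>t\<in>A'. Const (c t) * monom_val F (\<tau> t))"
  have eq: "(\<Sum>t\<in>A. Const (c t) * monom_val F t) = F r ^ e * Q"
  proof -
    have "(\<Sum>t\<in>A. Const (c t) * monom_val F t) = (\<Sum>t\<in>A'. Const (c t) * monom_val F t)"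
      unfolding A'_def using A(1) by (intro sum.mono_neutral_right) (auto simp: Const_def)
    also have "\<dots> = (\<Sum>t\<in>A'. F r ^ e * (Const (c t) * monom_val F (\<tau> t)))"
    proof (rule sum.cong)
      fix t assume "t \<in> A'"
      then have "monom_val F t = monom_val F (\<tau> t) * F r ^ e"
        using arg_cong[OF \<tau>, of t "monom_val F"] by (simp add: monom_val_plus)
      then show "Const (c t) * monom_val F t = F r ^ e * (Const (c t) * monom_val F (\<tau> t))"
        by (simp add: ac_simps)
    qed simp
    finally show ?thesis by (simp add: Q_def sum_distrib_left)
  qed
  have "monom_val F (\<tau> t) \<in> homog I (w - e * d r)" if "t \<in> A'" for t
    using homog_monom_val[of "\<tau> t" F I d] keys_\<tau>[OF that] hom wt_\<tau>[OF that] by auto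
  then have "Const (c t) * monom_val F (\<tau> t) \<in> homog I (0 + (w - e * d r))" if "t \<in> A'" for t
    using that by (intro homog_mult homog_Const) auto
  then have "Q \<in> homog I (0 + (w - e * d r))" unfolding Q_def by (intro homog_sum)
  then have "Q \<in> forms I" using forms_iff_homog by blast
  moreover have "F r ^ e \<in> forms I" using homog_power[OF hom[of r]] forms_iff_homog by blast
  moreover have "\<not> (\<forall>x\<in>C'. mpoly_eval (F r ^ e) x = 0)"
    using nonvan by (auto simp: ev.hom_power)
  ultimately have "\<forall>x\<in>C'. mpoly_eval Q x = 0"
    using prime[of "F r ^ e" Q] rel eq by metis
  then have QC: "\<forall>x\<in>C. mpoly_eval Q x = 0" using sub by blast
  define A0 where "A0 = {t\<in>A'. Poly_Mapping.lookup t r = e}"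
  have \<tau>_inj: "inj_on \<tau> A0"
    using \<tau> by (intro inj_onI) (metis (no_types, lifting) A0_def mem_Collect_eq)
  have "mpoly_eval (\<Sum>s\<in>\<tau> ` A0. Const (c (s + Poly_Mapping.single r e)) * monom_val F s) x = 0"
    if x: "x \<in> C" for x
  proof -
    have "0 = (\<Sum>t\<in>A'. mpoly_eval (Const (c t) * monom_val F (\<tau> t)) x)"
      using QC x by (simp add: Q_def ev.hom_sum)
    also have "\<dots> = (\<Sum>t\<in>A0. mpoly_eval (Const (c t) * monom_val F (\<tau> t)) x)"
    proof (rule sum.mono_neutral_right)
      show "\<forall>t\<in>A' - A0. mpoly_eval (Const (c t) * monom_val F (\<tau> t)) x = 0"
      proof
        fix t assume "t \<in> A' - A0"
        then have "r \<in> Poly_Mapping.keys (\<tau> t)"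
          using e_le by (force simp: A0_def in_keys_iff lookup_\<tau>)
        then have "monom_val (\<lambda>i. mpoly_eval (F i) x) (\<tau> t) = 0"
          unfolding monom_val_def using van x by (intro prod_zero bexI[of _ r]) (auto simp: in_keys_iff)
        then show "mpoly_eval (Const (c t) * monom_val F (\<tau> t)) x = 0"
          by (simp add: ev.hom_mult ev.hom_monom_val)
      qed
    qed (use A' in \<open>auto simp: A0_def\<close>)
    also have "\<dots> = (\<Sum>t\<in>A0. mpoly_eval (Const (c (\<tau> t + Poly_Mapping.single r e)) * monom_val F (\<tau> t)) x)"
      by (rule sum.cong) (use \<tau> in \<open>auto simp: A0_def\<close>)
    also have "\<dots> = mpoly_eval (\<Sum>s\<in>\<tau> ` A0. Const (c (s + Poly_Mapping.single r e)) * monom_val F s) x"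
      by (simp add: sum.reindex[OF \<tau>_inj] ev.hom_sum)
    finally show ?thesis by simp
  qed
  moreover have "Poly_Mapping.keys s \<subseteq> {..<r} \<and> wt d s = w - e * d r" if s: "s \<in> \<tau> ` A0" for s
  proof -
    obtain t where t: "t \<in> A'" "Poly_Mapping.lookup t r = e" "s = \<tau> t" using s by (auto simp: A0_def)
    have "r \<notin> Poly_Mapping.keys s" using t by (simp add: in_keys_iff lookup_\<tau>)
    then have "Poly_Mapping.keys s \<subseteq> {..<r}"
      using keys_\<tau>[OF t(1)] t(3) by (metis lessThan_Suc_atMost lessThan_Suc subset_insert)
    then show ?thesis using wt_\<tau> t by blast
  qed
  moreover have "finite (\<tau> ` A0)" using A' by (auto simp: A0_def)
  ultimately have "\<forall>s\<in>\<tau> ` A0. c (s + Poly_Mapping.single r e) = 0"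
    using ind[unfolded hom_indep_def, rule_format, of "\<tau> ` A0" "w - e * d r" "\<lambda>s. c (s + Poly_Mapping.single r e)"]
    by blast
  then have "c t0 = 0" using t0 \<tau>[OF t0(1)] by (auto simp: A0_def)
  then show False using t0 by (auto simp: A'_def)
qed

text \<open>
  The first form is a coordinate that does not vanish on the smallest set; each strict inclusion then contributes one
  more form, which separates the two sets.
\<close>

lemma chain_hom_indep:
  fixes Z :: "nat \<Rightarrow> ('v, 'k::field) proj_point set"
  assumes C: "closedin (zariski I) C"
    and "\<And>i. i \<le> n \<Longrightarrow> irreducible_closed (subtopology (zariski I) C) (Z i)"
    and "\<And>i. i < n \<Longrightarrow> Z i \<subset> Z (Suc i)"
  shows "\<exists>F d. (\<forall>i\<le>n. F i \<in> (homog I (d i) :: ('v, 'k) mpoly set)) \<and> hom_indep d F (Suc n) (\<Union>(Z n))"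
  using assms(2,3)
proof (induction n)
  case 0
  have Z0: "Z 0 \<noteq> {}" "Z 0 \<subseteq> C"
    using 0(1)[of 0] closedin_subset unfolding irreducible_closed_def by fastforce+
  then obtain P where P: "P \<in> Z 0" "P \<in> proj_space I" using closedin_subset[OF C] by auto
  obtain x where x: "x \<in> P" "P = proj_pt x" using P(2) proj_space_nonempty by blast
  then obtain v where v: "v \<in> I" "x v \<noteq> 0"
    using P(2) unfolding x(2) proj_pt_in_proj_space by blast
  have "hom_indep (\<lambda>_. 1) (\<lambda>_. Var v :: ('v, 'k) mpoly) (Suc 0) (\<Union>(Z 0))"
    unfolding hom_indep_def
  proof (intro allI impI ballI)
    fix A c w t
    assume A: "finite A" "\<forall>t\<in>A. Poly_Mapping.keys t \<subseteq> {..<Suc 0} \<and> wt (\<lambda>_. 1) t = w"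
      and 0: "\<forall>x\<in>\<Union> (Z 0). mpoly_eval (\<Sum>t\<in>A. Const (c t) * monom_val (\<lambda>_. Var v :: ('v, 'k) mpoly) t) x = 0"
      and t: "t \<in> A"
    have single: "s = Poly_Mapping.single 0 w" if "s \<in> A" for s
    proof -
      have k: "Poly_Mapping.keys s \<subseteq> {0}" using A(2) that by auto
      then have "wt (\<lambda>_. 1) s = Poly_Mapping.lookup s 0" by (subst wt_superset[of "{0}"]) auto
      then have "Poly_Mapping.lookup s 0 = w" using A(2) that by auto
      then show ?thesis using k
        by (intro poly_mapping_eqI) (auto simp: lookup_single when_def in_keys_iff)
    qed
    then have "A = {t}" "t = Poly_Mapping.single 0 w" using t by auto
    then have "mpoly_eval (Const (c t) * Var v ^ w) x = 0"
      using 0 P x by auto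
    then show "c t = 0" using v by (simp add: ev.hom_mult ev.hom_power)
  qed
  then show ?case using homog_Var[OF v(1)] by (intro exI[of _ "\<lambda>_. Var v"] exI[of _ "\<lambda>_. 1"]) auto
next
  case (Suc n)
  obtain F d where F: "\<And>i. i \<le> n \<Longrightarrow> F i \<in> (homog I (d i) :: ('v, 'k) mpoly set)"
    "hom_indep d F (Suc n) (\<Union>(Z n))"
    using Suc.IH Suc.prems by (metis le_SucI less_SucI)
  have irr: "irreducible_closed (subtopology (zariski I) C) (Z i)" if "i \<le> Suc n" for i
    using Suc.prems that by blast
  have ZC: "Z i \<subseteq> C" "closedin (zariski I) (Z i)" "Z i \<subseteq> proj_space I" if "i \<le> Suc n" for i
  proof -
    have "closedin (subtopology (zariski I) C) (Z i)" using irr[OF that] by (simp add: irreducible_closed_def)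
    then show "Z i \<subseteq> C" "closedin (zariski I) (Z i)" 
      using closedin_subset closedin_trans_full[OF _ C] by fastforce+
    then show "Z i \<subseteq> proj_space I" using closedin_subset by fastforce
  qed
  obtain Q where Q: "Q \<in> Z (Suc n)" "Q \<notin> Z n" "Q \<in> proj_space I"
    using Suc.prems(2)[of n] ZC(3)[of "Suc n"] by auto
  have Zn: "closedin (zariski I) (Z n)" using ZC(2)[of n] by simp
  obtain G :: "('v, 'k) mpoly" where G: "G \<in> forms I" "Z n \<subseteq> hypersurface I G" "Q \<notin> hypersurface I G"
    using zariski_separating_form[OF Zn Q(3,2)] by blast
  obtain k where k: "G \<in> homog I k" using G forms_iff_homog by blast
  let ?F = "F(Suc n := G)" and ?d = "d(Suc n := k)"
  have "hom_indep ?d ?F (Suc (Suc n)) (\<Union>(Z (Suc n)))"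
  proof (rule hom_indep_Suc)
    show "hom_indep ?d ?F (Suc n) (\<Union>(Z n))" by (rule hom_indep_cong[OF F(2)]) auto
    show "\<Union>(Z n) \<subseteq> \<Union>(Z (Suc n))" using Suc.prems(2)[of n] by auto
    show "?F i \<in> homog I (?d i)" if "i \<le> Suc n" for i using that F(1) k by (cases "i = Suc n") auto
    show "\<forall>x\<in>\<Union>(Z n). mpoly_eval (?F (Suc n)) x = 0"
      using G(1,2) ZC[of n] by (simp add: subset_hypersurface_iff)
    show "\<exists>x\<in>\<Union>(Z (Suc n)). mpoly_eval (?F (Suc n)) x \<noteq> 0"
      using G(3) Q ZC(3)[of "Suc n"] by (auto simp: hypersurface_def)
  next
    fix g h :: "('v, 'k) mpoly"
    assume gh: "g \<in> forms I" "h \<in> forms I" "\<forall>x\<in>\<Union>(Z (Suc n)). mpoly_eval (g * h) x = 0"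
    then have "Z (Suc n) \<subseteq> hypersurface I (g * h)"
      using ZC[of "Suc n"] by (simp add: subset_hypersurface_iff forms_mult)
    then show "(\<forall>x\<in>\<Union>(Z (Suc n)). mpoly_eval g x = 0) \<or> (\<forall>x\<in>\<Union>(Z (Suc n)). mpoly_eval h x = 0)"
      using irreducible_closed_prime[OF C irr[of "Suc n"] gh(1,2)] gh ZC(3)[of "Suc n"]
      by (simp add: subset_hypersurface_iff)
  qed
  moreover have "\<forall>i\<le>Suc n. ?F i \<in> homog I (?d i)" using F(1) k by (auto simp: le_Suc_eq)
  ultimately show ?case by blast
qed

section \<open>Independent forms on the image of a polynomial map\<close>

text \<open>
  Gaussian elimination: there are more unknowns, indexed by \<open>A\<close>, than equations, indexed by
  \<open>B\<close>.
\<close>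

lemma homogeneous_system_nontrivial_solution:
  fixes M :: "'a \<Rightarrow> 'b \<Rightarrow> 'k::field"
  assumes "finite B" "finite A" "card B < card A"
  shows "\<exists>c. (\<exists>a\<in>A. c a \<noteq> 0) \<and> (\<forall>b\<in>B. (\<Sum>a\<in>A. c a * M a b) = 0)"
  using assms
proof (induction B arbitrary: A M rule: finite_induct)
  case empty
  then show ?case by (intro exI[of _ "\<lambda>_. 1"]) (auto simp: card_gt_0_iff)
next
  case (insert b B)
  show ?case
  proof (cases "\<forall>a\<in>A. M a b = 0")
    case True
    have "card B < card A" using insert by simp
    then obtain c where "\<exists>a\<in>A. c a \<noteq> 0" "\<forall>b\<in>B. (\<Sum>a\<in>A. c a * M a b) = 0"
      using insert.IH[OF insert.prems(1), of M] by blast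
    then show ?thesis using True by (intro exI[of _ c]) auto
  next
    case False
    then obtain p where p: "p \<in> A" "M p b \<noteq> 0" by blast
    let ?A = "A - {p}"
    define M' where "M' a b' = M a b' - M a b / M p b * M p b'" for a b'
    have "card B < card ?A" "finite ?A" using insert p by auto
    then obtain c where c: "\<exists>a\<in>?A. c a \<noteq> 0" "\<forall>b'\<in>B. (\<Sum>a\<in>?A. c a * M' a b') = 0"
      using insert.IH[of ?A M'] by blast
    \<comment> \<open>The value at the pivot \<open>p\<close> solves equation \<open>b\<close> for that unknown.\<close>
    define c' where "c' = c(p := - (\<Sum>a\<in>?A. c a * M a b) / M p b)"
    have "(\<Sum>a\<in>A. c' a * M a b') = (\<Sum>a\<in>?A. c a * M' a b')" for b'
    proof -
      have "(\<Sum>a\<in>A. c' a * M a b') = c' p * M p b' + (\<Sum>a\<in>?A. c' a * M a b')"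
        using insert.prems(1) p(1) by (rule sum.remove)
      also have "(\<Sum>a\<in>?A. c' a * M a b') = (\<Sum>a\<in>?A. c a * M a b')"
        by (rule sum.cong) (auto simp: c'_def)
      also have "c' p * M p b' = - (\<Sum>a\<in>?A. c a * (M a b / M p b * M p b'))"
        by (simp add: c'_def sum_distrib_left sum_divide_distrib ac_simps)
      finally show ?thesis
        by (simp add: M'_def right_diff_distrib sum_subtractf)
    qed
    moreover have "M' a b = 0" for a using p by (simp add: M'_def)
    ultimately have "\<forall>b'\<in>insert b B. (\<Sum>a\<in>A. c' a * M a b') = 0" using c(2) by simp
    moreover have "\<exists>a\<in>A. c' a \<noteq> 0" using c(1) by (auto simp: c'_def)
    ultimately show ?thesis by blast
  qed
qed

definition exponent_box :: "'i set \<Rightarrow> nat \<Rightarrow> ('i \<Rightarrow>\<^sub>0 nat) set" where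
  "exponent_box J D = {t. Poly_Mapping.keys t \<subseteq> J \<and> (\<forall>i. Poly_Mapping.lookup t i \<le> D)}"

lemma bij_betw_exponent_box:
  assumes "finite J"
  shows "bij_betw (\<lambda>t. restrict (Poly_Mapping.lookup t) J) (exponent_box J D) (J \<rightarrow>\<^sub>E {..D})"
proof (rule bij_betwI')
  fix t u assume t: "t \<in> exponent_box J D" and u: "u \<in> exponent_box J D"
  have "t = u" if eq: "restrict (Poly_Mapping.lookup t) J = restrict (Poly_Mapping.lookup u) J"
  proof (rule poly_mapping_eqI)
    fix i
    show "Poly_Mapping.lookup t i = Poly_Mapping.lookup u i"
    proof (cases "i \<in> J")
      case True
      then show ?thesis using fun_cong[OF eq, of i] by simp
    next
      case False
      then have "i \<notin> Poly_Mapping.keys t" "i \<notin> Poly_Mapping.keys u"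
        using t u by (auto simp: exponent_box_def)
      then show ?thesis by (simp add: in_keys_iff)
    qed
  qed
  then show "restrict (Poly_Mapping.lookup t) J = restrict (Poly_Mapping.lookup u) J \<longleftrightarrow> t = u" by blast
next
  fix t assume "t \<in> exponent_box J D"
  then show "restrict (Poly_Mapping.lookup t) J \<in> J \<rightarrow>\<^sub>E {..D}"
    by (auto simp: exponent_box_def)
next
  fix f assume f: "f \<in> J \<rightarrow>\<^sub>E {..D}"
  let ?f = "\<lambda>i. if i \<in> J then f i else 0"
  let ?t = "Abs_poly_mapping ?f"
  have "finite {i. ?f i \<noteq> 0}" using assms by (rule rev_finite_subset) auto
  then have l: "Poly_Mapping.lookup ?t = ?f" by (rule lookup_Abs_poly_mapping)
  then have "?t \<in> exponent_box J D"
    using f by (auto simp: exponent_box_def in_keys_iff split: if_splits)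
  moreover have "restrict (Poly_Mapping.lookup ?t) J = f"
    unfolding l using f by (auto simp: restrict_def PiE_def extensional_def)
  ultimately show "\<exists>t\<in>exponent_box J D. f = restrict (Poly_Mapping.lookup t) J" by metis
qed

lemma exponent_box_finite_card:
  assumes "finite J"
  shows "finite (exponent_box J D)" "card (exponent_box J D) = Suc D ^ card J"
proof -
  have "finite (J \<rightarrow>\<^sub>E {..D})" using assms by (auto intro: finite_PiE)
  then show "finite (exponent_box J D)" using bij_betw_finite[OF bij_betw_exponent_box[OF assms]] by blast
  show "card (exponent_box J D) = Suc D ^ card J"
    using bij_betw_same_card[OF bij_betw_exponent_box[OF assms]] by (simp add: card_PiE assms)
qed

lemma lookup_Const_mult:
  "Poly_Mapping.lookup (Const c * p) t = c * Poly_Mapping.lookup (p :: ('v, 'k::comm_ring_1) mpoly) t"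
  unfolding Const_def mult_map_scale_conv_mult[symmetric]
  by (auto simp: map.rep_eq when_def)

lemma homog_keys_in_box: "p \<in> homog J n \<Longrightarrow> n \<le> D \<Longrightarrow> Poly_Mapping.keys p \<subseteq> exponent_box J D"
  using lookup_le_wt[of "\<lambda>_. 1"] by (fastforce simp: homog_def exponent_box_def intro: order_trans)

lemma wt_le_sum:
  assumes "t \<in> exponent_box J D" "finite J"
  shows "wt d t \<le> D * sum d J"
proof -
  have "wt d t = (\<Sum>v\<in>J. Poly_Mapping.lookup t v * d v)"
    using assms by (intro wt_superset) (auto simp: exponent_box_def)
  also have "\<dots> \<le> (\<Sum>v\<in>J. D * d v)"
    using assms by (intro sum_mono) (auto simp: exponent_box_def)
  finally show ?thesis by (simp add: sum_distrib_left)
qed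

text \<open>
  The number of monomials in \<open>r\<close> variables with exponents up to \<open>D\<close> is a polynomial of
  degree \<open>r\<close> in \<open>D\<close>, and so it eventually exceeds the number of monomials in fewer
  variables, even if the exponents of the latter are allowed to be larger by a constant factor \<open>s\<close>.
\<close>

lemma exists_box_growth:
  fixes s :: nat
  assumes "m < r"
  shows "\<exists>D. Suc (D * s) ^ m < Suc D ^ r"
proof -
  let ?D = "Suc s ^ m"
  have "Suc (?D * s) \<le> Suc s * Suc ?D" by (simp add: algebra_simps)
  then have "Suc (?D * s) ^ m \<le> (Suc s * Suc ?D) ^ m" by (rule power_mono) simp
  also have "\<dots> = ?D * Suc ?D ^ m" by (simp only: power_mult_distrib)
  also have "\<dots> < Suc ?D * Suc ?D ^ m" by simp
  also have "\<dots> = Suc ?D ^ Suc m" by simp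
  also have "\<dots> \<le> Suc ?D ^ r" using assms by (intro power_increasing) auto
  finally show ?thesis by blast
qed

definition poly_map :: "('v \<Rightarrow> (nat, 'k::field) mpoly) \<Rightarrow> (nat \<Rightarrow> 'k alg_closure) \<Rightarrow> 'v \<Rightarrow> 'k alg_closure" where
  "poly_map \<phi> u = (\<lambda>v. mpoly_eval (\<phi> v) u)"

interpretation subst: comm_ring_hom "subst \<phi> :: _ \<Rightarrow> ('w, 'k::field) mpoly" for \<phi>
  unfolding subst_def by (rule comm_ring_hom.comm_ring_hom_mpoly_hom[OF comm_ring_hom_Const])

lemma subst_Const: "subst \<phi> (Const c) = (Const c :: ('w, 'k::field) mpoly)"
  unfolding subst_def by (rule comm_ring_hom.mpoly_hom_Const[OF comm_ring_hom_Const])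

text \<open>
  If \<open>r > m\<close>, the monomials in \<open>F 0 \<circ> \<phi>, \<dots>, F (r - 1) \<circ> \<phi>\<close> with
  exponents up to a large \<open>D\<close> are more numerous than the monomials in \<open>m\<close> variables that can
  occur in them. This forces a linear relation, and since \<open>k > 0\<close> its homogeneous parts have disjoint
  sets of monomials, so each of them is a relation; a nontrivial one contradicts the independence.
\<close>

lemma hom_indep_on_image_le:
  fixes F :: "nat \<Rightarrow> ('v, 'k::field) mpoly" and \<phi> :: "'v \<Rightarrow> (nat, 'k) mpoly"
  assumes F: "\<And>i. i < r \<Longrightarrow> F i \<in> homog I (d i)" and ind: "hom_indep d F r C"
    and \<phi>: "\<And>v. v \<in> I \<Longrightarrow> \<phi> v \<in> homog {..<m} k" and k: "k > 0"
    and C: "\<And>x. x \<in> C \<Longrightarrow> \<exists>u c. x = (\<lambda>v. c * poly_map \<phi> u v)"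
  shows "r \<le> m"
proof (rule ccontr)
  assume "\<not> r \<le> m"
  \<comment> \<open>A monomial with exponents up to \<open>D\<close> in the \<open>F i \<circ> \<phi>\<close> has degree at most \<open>D * (s * k)\<close>.\<close>
  define s where "s = sum d {..<r}"
  obtain D where D: "Suc (D * (s * k)) ^ m < Suc D ^ r"
    using exists_box_growth[of m r "s * k"] \<open>\<not> r \<le> m\<close> by auto
  define A where "A = exponent_box {..<r} D"
  define B where "B = exponent_box {..<m} (D * (s * k))"
  define P where "P t = subst \<phi> (monom_val F t)" for t
  have AB: "finite A" "finite B" "card B < card A"
    using D by (simp_all add: A_def B_def exponent_box_finite_card)
  have mF: "monom_val F t \<in> homog I (wt d t)" if "t \<in> A" for t
    using that by (intro homog_monom_val F) (auto simp: A_def exponent_box_def)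
  have P: "P t \<in> homog {..<m} (wt d t * k)" if "t \<in> A" for t
    unfolding P_def using mF[OF that] by (rule homog_subst) (rule \<phi>)
  have keysP: "Poly_Mapping.keys (P t) \<subseteq> B" if "t \<in> A" for t
  proof -
    have "wt d t \<le> D * s" using that unfolding A_def s_def by (rule wt_le_sum) simp
    then have "wt d t * k \<le> D * (s * k)" by (metis mult.assoc mult_le_mono1)
    then show ?thesis unfolding B_def by (rule homog_keys_in_box[OF P[OF that]])
  qed
  obtain c where c: "\<exists>t\<in>A. c t \<noteq> 0" "\<forall>b\<in>B. (\<Sum>t\<in>A. c t * Poly_Mapping.lookup (P t) b) = 0"
    using homogeneous_system_nontrivial_solution[OF AB(2,1,3), of "\<lambda>t. Poly_Mapping.lookup (P t)"] by blast
  then obtain t0 where t0: "t0 \<in> A" "c t0 \<noteq> 0" by blast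
  \<comment> \<open>The part of the relation in the weight of \<open>t0\<close> is a relation by itself.\<close>
  define w where "w = wt d t0"
  define Aw where "Aw = {t\<in>A. wt d t = w}"
  have Aw: "finite Aw" "Aw \<subseteq> A" using AB by (auto simp: Aw_def)
  have R0: "(\<Sum>t\<in>Aw. Const (c t) * P t) = 0"
  proof (rule poly_mapping_eqI)
    fix b
    have "(\<Sum>t\<in>Aw. c t * Poly_Mapping.lookup (P t) b) = 0"
    proof (cases "\<exists>t\<in>Aw. b \<in> Poly_Mapping.keys (P t)")
      case True
      then obtain t where t: "t \<in> Aw" "b \<in> Poly_Mapping.keys (P t)" by blast
      have bB: "b \<in> B" using t keysP Aw by blast
      have wb: "wt (\<lambda>_. 1) b = w * k" using P[of t] t by (auto simp: homog_def Aw_def)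
      have "Poly_Mapping.lookup (P t') b = 0" if "t' \<in> A - Aw" for t'
      proof -
        have "wt d t' * k \<noteq> w * k" using that k by (auto simp: Aw_def)
        then have "b \<notin> Poly_Mapping.keys (P t')" using P[of t'] that wb by (auto simp: homog_def)
        then show ?thesis by (simp add: in_keys_iff)
      qed
      then have "(\<Sum>t\<in>Aw. c t * Poly_Mapping.lookup (P t) b) = (\<Sum>t\<in>A. c t * Poly_Mapping.lookup (P t) b)"
        by (intro sum.mono_neutral_left AB(1) Aw(2)) auto
      then show ?thesis using c(2) bB by simp
    qed (auto simp: in_keys_iff)
    then show "Poly_Mapping.lookup (\<Sum>t\<in>Aw. Const (c t) * P t) b = Poly_Mapping.lookup 0 b"
      by (simp add: lookup_sum lookup_Const_mult)
  qed
  let ?Q = "\<Sum>t\<in>Aw. Const (c t) * monom_val F t"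
  have "Const (c t) * monom_val F t \<in> homog I (0 + w)" if "t \<in> Aw" for t
    using mF[of t] that by (intro homog_mult homog_Const) (auto simp: Aw_def)
  then have Q: "?Q \<in> homog I (0 + w)" by (rule homog_sum)
  have "mpoly_eval ?Q x = 0" if "x \<in> C" for x
  proof -
    obtain u a where x: "x = (\<lambda>v. a * poly_map \<phi> u v)" using C[OF \<open>x \<in> C\<close>] by blast
    have "mpoly_eval ?Q (poly_map \<phi> u) = mpoly_eval (subst \<phi> ?Q) u"
      by (simp add: eval_subst poly_map_def)
    also have "subst \<phi> ?Q = 0"
      using R0 by (simp add: subst.hom_sum subst.hom_mult subst_Const P_def)
    finally show ?thesis unfolding x mpoly_hom_scale[OF Q] by simp
  qed
  moreover have "\<forall>t\<in>Aw. Poly_Mapping.keys t \<subseteq> {..<r} \<and> wt d t = w"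
    by (auto simp: Aw_def A_def exponent_box_def)
  ultimately have "\<forall>t\<in>Aw. c t = 0" using ind Aw(1) unfolding hom_indep_def by blast
  then show False using t0 by (auto simp: Aw_def w_def)
qed

section \<open>Dimension of the closure of an image\<close>

text \<open>
  Vectors that are mapped to zero do not define a point; they are discarded by the intersection.
\<close>

definition image_pts ::
  "'v set \<Rightarrow> ('v \<Rightarrow> (nat, 'k::field) mpoly) \<Rightarrow> (nat \<Rightarrow> 'k alg_closure) set \<Rightarrow> ('v, 'k) proj_point set" where
  "image_pts I \<phi> L = {proj_pt (poly_map \<phi> u) | u. u \<in> L} \<inter> proj_space I"

lemma image_pts_subset [simp]: "image_pts I \<phi> L \<subseteq> proj_space I"
  by (simp add: image_pts_def)

lemma restrict_to_line:
  fixes g :: "('v, 'k::field) mpoly"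
  obtains q :: "'k alg_closure poly"
  where "\<And>t. poly q t = mpoly_eval g (poly_map \<phi> (\<lambda>i. a i + t * (b i - a i)))"
proof
  fix t
  have hom: "comm_ring_hom (\<lambda>q :: 'k alg_closure poly. poly q t)" by standard auto
  show "poly (mpoly_hom (\<lambda>c. [:to_ac c:]) (\<lambda>i. [:a i, b i - a i:]) (subst \<phi> g)) t =
      mpoly_eval g (poly_map \<phi> (\<lambda>i. a i + t * (b i - a i)))"
    by (simp add: comm_ring_hom.hom_mpoly_hom[OF hom] eval_subst poly_map_def)
qed

text \<open>
  Join a vector where \<open>g\<close> does not vanish and a vector where \<open>h\<close> does not vanish by a line.
  On it, \<open>g\<close>, \<open>h\<close> and a suitable coordinate are nonzero polynomials in one parameter, so
  some parameter is a root of none of them. The coordinate ensures that the image of the vector found is a point.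
\<close>

lemma image_pts_not_covered:
  fixes g h :: "('v, 'k::field_char_0) mpoly"
  assumes L: "\<And>a b t. a \<in> L \<Longrightarrow> b \<in> L \<Longrightarrow> (\<lambda>i. a i + t * (b i - a i)) \<in> L"
    and supp: "\<And>v. v \<notin> I \<Longrightarrow> \<phi> v = 0"
    and gh: "g \<in> forms I" "h \<in> forms I"
    and g: "\<not> image_pts I \<phi> L \<subseteq> hypersurface I g" and h: "\<not> image_pts I \<phi> L \<subseteq> hypersurface I h"
  shows "\<not> image_pts I \<phi> L \<subseteq> hypersurface I g \<union> hypersurface I h"
proof -
  obtain a where a: "a \<in> L" "proj_pt (poly_map \<phi> a) \<in> proj_space I" "proj_pt (poly_map \<phi> a) \<notin> hypersurface I g"
    using g by (auto simp: image_pts_def)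
  obtain b where b: "b \<in> L" "proj_pt (poly_map \<phi> b) \<in> proj_space I" "proj_pt (poly_map \<phi> b) \<notin> hypersurface I h"
    using h by (auto simp: image_pts_def)
  obtain v where v: "v \<in> I" "poly_map \<phi> a v \<noteq> 0" using a(2) unfolding proj_pt_in_proj_space by blast
  define l where "l t = (\<lambda>i. a i + t * (b i - a i))" for t
  have l: "l 0 = a" "l 1 = b" by (auto simp: l_def)
  obtain pg where pg: "\<And>t. poly pg t = mpoly_eval g (poly_map \<phi> (l t))"
    unfolding l_def by (rule restrict_to_line[where g = g and \<phi> = \<phi> and a = a and b = b]) blast
  obtain ph where ph: "\<And>t. poly ph t = mpoly_eval h (poly_map \<phi> (l t))"
    unfolding l_def by (rule restrict_to_line[where g = h and \<phi> = \<phi> and a = a and b = b]) blast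
  obtain pv where pv: "\<And>t. poly pv t = mpoly_eval (Var v) (poly_map \<phi> (l t))"
    unfolding l_def by (rule restrict_to_line[where g = "Var v" and \<phi> = \<phi> and a = a and b = b]) blast
  have "poly pg 0 \<noteq> 0" "poly ph 1 \<noteq> 0" "poly pv 0 \<noteq> 0"
    using a(3) b(3) mem_hypersurface_iff[OF gh(1) a(2) proj_pt_self]
      mem_hypersurface_iff[OF gh(2) b(2) proj_pt_self] v(2) by (auto simp: pg ph pv l)
  then have "pg * ph * pv \<noteq> 0" by auto
  then have "finite {t. poly (pg * ph * pv) t = 0}" by (rule poly_roots_finite)
  moreover have "infinite (UNIV :: 'k alg_closure set)" by (rule infinite_UNIV_char_0)
  ultimately have "{t. poly (pg * ph * pv) t = 0} \<noteq> UNIV" by metis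
  then obtain t where t: "poly (pg * ph * pv) t \<noteq> 0" by blast
  let ?P = "proj_pt (poly_map \<phi> (l t))"
  have P: "?P \<in> proj_space I"
    unfolding proj_pt_in_proj_space using t v(1) by (auto simp: pv poly_map_def supp ev.hom_zero)
  have "?P \<notin> hypersurface I g" "?P \<notin> hypersurface I h"
    using t mem_hypersurface_iff[OF gh(1) P proj_pt_self] mem_hypersurface_iff[OF gh(2) P proj_pt_self]
    by (auto simp: pg ph)
  moreover have "?P \<in> image_pts I \<phi> L"
    using P L[OF a(1) b(1), of t] unfolding image_pts_def l_def by blast
  ultimately show ?thesis by blast
qed

lemma image_pts_mono: "L \<subseteq> L' \<Longrightarrow> image_pts I \<phi> L \<subseteq> image_pts I \<phi> L'"
  by (auto simp: image_pts_def)

text \<open>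
  A nonempty open subset of an irreducible set is dense.
\<close>

lemma image_pts_dense:
  fixes h :: "('v, 'k::field_char_0) mpoly"
  assumes supp: "\<And>v. v \<notin> I \<Longrightarrow> \<phi> v = 0"
    and h: "h \<in> forms I" "\<not> image_pts I \<phi> UNIV \<subseteq> hypersurface I h"
    and T: "image_pts I \<phi> UNIV - hypersurface I h \<subseteq> T" "T \<subseteq> proj_space I"
  shows "image_pts I \<phi> UNIV \<subseteq> zariski_closure I T"
proof (rule ccontr)
  let ?Y = "image_pts I \<phi> UNIV"
  assume "\<not> ?Y \<subseteq> zariski_closure I T"
  then obtain P where P: "P \<in> ?Y" "P \<notin> zariski_closure I T" by blast
  then have "P \<in> proj_space I" using image_pts_subset by blast
  then obtain g :: "('v, 'k) mpoly" where g: "g \<in> forms I" "zariski_closure I T \<subseteq> hypersurface I g" "P \<notin> hypersurface I g"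
    using zariski_separating_form[OF closedin_closure_of _ P(2)] by blast
  have "\<not> ?Y \<subseteq> hypersurface I g" using P(1) g(3) by blast
  then have "\<not> ?Y \<subseteq> hypersurface I g \<union> hypersurface I h"
    using image_pts_not_covered[of UNIV, OF _ supp g(1) h(1) _ h(2)] by simp
  moreover have "T \<subseteq> hypersurface I g" using subset_zariski_closure[OF T(2)] g(2) by blast
  ultimately show False using T(1) by blast
qed

text \<open>
  A form that vanishes on \<open>T\<close> vanishes on its closure, so restricting to \<open>T\<close> creates no new
  relations.
\<close>

lemma hom_indep_closure:
  fixes F :: "nat \<Rightarrow> ('v, 'k::field) mpoly"
  assumes ind: "hom_indep d F r (\<Union>(zariski_closure I T))" and T: "T \<subseteq> proj_space I"
    and F: "\<And>i. i < r \<Longrightarrow> F i \<in> homog I (d i)"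
  shows "hom_indep d F r (\<Union>T)"
  unfolding hom_indep_def
proof (intro allI impI)
  fix A c w
  assume A: "finite A" "\<forall>t\<in>A. Poly_Mapping.keys t \<subseteq> {..<r} \<and> wt d t = w"
    and 0: "\<forall>x\<in>\<Union>T. mpoly_eval (\<Sum>t\<in>A. Const (c t) * monom_val F t) x = 0"
  let ?Q = "\<Sum>t\<in>A. Const (c t) * monom_val F t"
  have "Const (c t) * monom_val F t \<in> homog I (0 + w)" if t: "t \<in> A" for t
  proof -
    have "monom_val F t \<in> homog I (wt d t)" using A(2) t by (intro homog_monom_val F) auto
    then show ?thesis using A(2) t by (intro homog_mult homog_Const) auto
  qed
  then have "?Q \<in> homog I (0 + w)" by (rule homog_sum)
  then have Q: "?Q \<in> forms I" unfolding forms_iff_homog by blast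
  then have "T \<subseteq> hypersurface I ?Q" using 0 T by (simp add: subset_hypersurface_iff)
  then have "zariski_closure I T \<subseteq> hypersurface I ?Q" by (rule closure_subset_hypersurface[OF Q])
  then have "\<forall>x\<in>\<Union>(zariski_closure I T). mpoly_eval ?Q x = 0"
    by (auto simp: hypersurface_def)
  then show "\<forall>t\<in>A. c t = 0" using ind A unfolding hom_indep_def by blast
qed

lemma variety_dim_closure_le:
  fixes \<phi> :: "'v \<Rightarrow> (nat, 'k::field) mpoly"
  assumes T: "T \<subseteq> image_pts I \<phi> UNIV"
    and \<phi>: "\<And>v. v \<in> I \<Longrightarrow> \<phi> v \<in> homog {..<m} k" and k: "k > 0"
  shows "variety_dim I (zariski_closure I T) \<le> enat (m - 1)"
  unfolding variety_dim_def krull_dim_def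
proof (rule Sup_least, clarify)
  fix n and Z :: "nat \<Rightarrow> ('v, 'k) proj_point set"
  let ?C = "zariski_closure I T"
  assume irr: "\<forall>i\<le>n. irreducible_closed (subtopology (zariski I) ?C) (Z i)"
    and chain: "\<forall>i<n. Z i \<subset> Z (Suc i)"
  have TP: "T \<subseteq> proj_space I" using T image_pts_subset by blast
  have "closedin (zariski I) ?C" by (rule closedin_closure_of)
  then obtain F d where F: "\<forall>i\<le>n. F i \<in> (homog I (d i) :: ('v, 'k) mpoly set)" "hom_indep d F (Suc n) (\<Union>(Z n))"
    using chain_hom_indep[of I ?C n Z] irr chain by blast
  have "closedin (subtopology (zariski I) ?C) (Z n)"
    using irr unfolding irreducible_closed_def by blast
  from closedin_subset[OF this] have "Z n \<subseteq> ?C" by simp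
  then have "hom_indep d F (Suc n) (\<Union>?C)"
    using hom_indep_mono[OF F(2)] by blast
  then have "hom_indep d F (Suc n) (\<Union>T)"
    by (rule hom_indep_closure) (use TP F(1) in auto)
  then have "Suc n \<le> m"
  proof (rule hom_indep_on_image_le[where I = I, rotated])
    fix x assume "x \<in> \<Union>T"
    then obtain u where "x \<in> proj_pt (poly_map \<phi> u)" using T by (auto simp: image_pts_def)
    then show "\<exists>u c. x = (\<lambda>v. c * poly_map \<phi> u v)" by (auto simp: proj_pt_def)
  qed (use F(1) \<phi> k in auto)
  then show "enat n \<le> enat (m - 1)" by simp
qed

lemma variety_dim_closure_ge:
  fixes \<phi> :: "'v \<Rightarrow> (nat, 'k::field_char_0) mpoly"
  assumes C: "closedin (zariski I) C" "image_pts I \<phi> UNIV \<subseteq> C"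
    and supp: "\<And>v. v \<notin> I \<Longrightarrow> \<phi> v = 0"
    and L: "\<And>i a b t. i \<le> n \<Longrightarrow> a \<in> L i \<Longrightarrow> b \<in> L i \<Longrightarrow> (\<lambda>j. a j + t * (b j - a j)) \<in> L i"
    and mono: "\<And>i. i < n \<Longrightarrow> L i \<subseteq> L (Suc i)"
    and ne: "image_pts I \<phi> (L 0) \<noteq> {}"
    and sep: "\<And>i. i < n \<Longrightarrow> \<exists>v\<in>I. (\<forall>u\<in>L i. poly_map \<phi> u v = 0) \<and> (\<exists>u\<in>L (Suc i). poly_map \<phi> u v \<noteq> 0)"
  shows "variety_dim I C \<ge> enat n"
proof -
  let ?S = "\<lambda>i. image_pts I \<phi> (L i)"
  let ?Z = "\<lambda>i. zariski_closure I (?S i)"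
  have ne': "?S i \<noteq> {}" if "i \<le> n" for i
    using that
  proof (induction i)
    case (Suc i)
    then show ?case using image_pts_mono[OF mono[of i], of I \<phi>] by auto
  qed (use ne in simp)
  have irr: "irreducible_closed (subtopology (zariski I) C) (?Z i)" if "i \<le> n" for i
  proof (rule irreducible_closure[OF C(1) _ ne'[OF that]])
    show "?S i \<subseteq> C" using image_pts_mono[of "L i" UNIV I \<phi>] C(2) by auto
  next
    fix g h :: "('v, 'k) mpoly"
    assume *: "g \<in> forms I" "h \<in> forms I" "\<not> ?S i \<subseteq> hypersurface I g" "\<not> ?S i \<subseteq> hypersurface I h"
    show "\<not> ?S i \<subseteq> hypersurface I g \<union> hypersurface I h"
      by (rule image_pts_not_covered[OF L[OF that] supp *])
  qed
  have "?Z i \<subset> ?Z (Suc i)" if i: "i < n" for i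
  proof
    show "?Z i \<subseteq> ?Z (Suc i)" by (intro closure_of_mono image_pts_mono mono i)
    obtain v u where v: "v \<in> I" "\<forall>u\<in>L i. poly_map \<phi> u v = 0" and u: "u \<in> L (Suc i)" "poly_map \<phi> u v \<noteq> 0"
      using sep[OF i] by blast
    have Var: "(Var v :: ('v, 'k) mpoly) \<in> forms I" using homog_Var[OF v(1)] forms_iff_homog by blast
    have "?S i \<subseteq> hypersurface I (Var v)"
    proof
      fix P assume "P \<in> ?S i"
      then obtain u' where u': "u' \<in> L i" "P = proj_pt (poly_map \<phi> u')" "P \<in> proj_space I"
        by (auto simp: image_pts_def)
      then show "P \<in> hypersurface I (Var v)"
        using mem_hypersurface_iff[OF Var, of P "poly_map \<phi> u'"] proj_pt_self v(2) by auto
    qed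
    then have Zi: "?Z i \<subseteq> hypersurface I (Var v)" by (rule closure_subset_hypersurface[OF Var])
    let ?P = "proj_pt (poly_map \<phi> u)"
    have P: "?P \<in> proj_space I"
      unfolding proj_pt_in_proj_space using u v(1) by (auto simp: poly_map_def supp ev.hom_zero)
    then have "?P \<in> ?S (Suc i)" using u(1) by (auto simp: image_pts_def)
    then have "?P \<in> ?Z (Suc i)" using subset_zariski_closure[OF image_pts_subset] by blast
    moreover have "?P \<notin> hypersurface I (Var v)"
      using mem_hypersurface_iff[OF Var P proj_pt_self] u(2) by simp
    ultimately show "?Z i \<noteq> ?Z (Suc i)" using Zi by blast
  qed
  then show ?thesis
    unfolding variety_dim_def krull_dim_def
    by (intro Sup_upper CollectI exI[of _ n] conjI refl exI[of _ ?Z] allI impI irr)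
qed

section \<open>Kernels, cofactors and the gradient of a determinant\<close>

lemma pderiv_sum: "pderiv (sum f A) = (\<Sum>a\<in>A. pderiv (f a))"
  using higher_pderiv_sum[of 1 f A] by simp

text \<open>
  The formal partial derivative agrees with the derivative along a coordinate line, expressed with the derivation on
  polynomials in one variable. This makes the product rule for polynomials in one variable applicable to the gradient
  of a determinant.
\<close>

lemma eval_pderiv_var:
  fixes f :: "('v, 'k::field) mpoly" and x :: "'v \<Rightarrow> 'k alg_closure" and v :: 'v
  defines "l \<equiv> (\<lambda>w. if w = v then [:x v, 1:] else [:x w:])"
  shows "mpoly_eval (pderiv_var v f) x = poly (pderiv (mpoly_hom (\<lambda>c. [:to_ac c:]) l f)) 0"
proof -
  have "poly (pderiv ([:to_ac c:] * monom_val l t)) 0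
      = mpoly_eval (Poly_Mapping.single (t - Poly_Mapping.single v 1) (of_nat (Poly_Mapping.lookup t v) * c)) x" for c t
  proof -
    let ?n = "Poly_Mapping.lookup t v"
    define t0 where "t0 = t - Poly_Mapping.single v ?n"
    have t: "t = t0 + Poly_Mapping.single v ?n"
      unfolding t0_def by (rule split_exponent) simp
    have t1: "t - Poly_Mapping.single v 1 = t0 + Poly_Mapping.single v (?n - 1)"
      by (intro poly_mapping_eqI) (auto simp: t0_def lookup_add lookup_minus lookup_single when_def)
    have v: "v \<notin> Poly_Mapping.keys t0" by (simp add: t0_def in_keys_iff lookup_minus)
    have "comm_ring_hom (\<lambda>a :: 'k alg_closure. [:a:])" by standard auto
    then have "[:monom_val x t0:] = monom_val (\<lambda>w. [:x w:]) t0" by (rule comm_ring_hom.hom_monom_val)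
    also have "\<dots> = monom_val l t0" using v by (intro monom_val_cong) (auto simp: l_def)
    finally have mv: "monom_val l t0 = [:monom_val x t0:]" ..
    have "[:to_ac c:] * monom_val l t = smult (to_ac c * monom_val x t0) ([:x v, 1:] ^ ?n)"
      by (subst t) (simp add: monom_val_plus mv, simp add: l_def mult.commute)
    then have "poly (pderiv ([:to_ac c:] * monom_val l t)) 0
        = to_ac c * monom_val x t0 * (of_nat ?n * x v ^ (?n - 1))"
      by (simp add: pderiv_smult pderiv_power pderiv_pCons poly_power)
    then show ?thesis
      by (simp only: t1 comm_ring_hom.mpoly_hom_single[OF comm_ring_hom_to_ac] monom_val_plus
          monom_val_single to_ac_mult to_ac_of_nat) (simp add: ac_simps)
  qed
  then show ?thesis
    by (simp only: pderiv_var_def ev.hom_sum mpoly_hom_altdef[of _ _ f] pderiv_sum poly_sum)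
qed

lemma cofactor_row_cong:
  assumes "A \<in> carrier_mat n n" "B \<in> carrier_mat n n"
    and "\<And>i' j'. i' < n \<Longrightarrow> j' < n \<Longrightarrow> i' \<noteq> i \<Longrightarrow> A $$ (i', j') = B $$ (i', j')"
  shows "cofactor A i j = cofactor B i j"
proof -
  have "mat_delete A i j = mat_delete B i j"
    using assms by (intro eq_matI) (auto simp: mat_delete_def)
  then show ?thesis by (simp add: cofactor_def)
qed

definition replace_row :: "'a mat \<Rightarrow> nat \<Rightarrow> (nat \<Rightarrow> 'a) \<Rightarrow> 'a mat" where
  "replace_row A i r = mat (dim_row A) (dim_col A) (\<lambda>(i', j). if i' = i then r j else A $$ (i', j))"

lemma replace_row_carrier: "A \<in> carrier_mat n n \<Longrightarrow> replace_row A i r \<in> carrier_mat n n"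
  by (simp add: replace_row_def)

lemma det_replace_row:
  fixes A :: "'a::comm_ring_1 mat"
  assumes A: "A \<in> carrier_mat n n" and i: "i < n"
  shows "det (replace_row A i r) = (\<Sum>j<n. r j * cofactor A i j)"
proof -
  have "det (replace_row A i r) = (\<Sum>j<n. replace_row A i r $$ (i, j) * cofactor (replace_row A i r) i j)"
    by (rule laplace_expansion_row[OF replace_row_carrier[OF A] i])
  also have "\<dots> = (\<Sum>j<n. r j * cofactor A i j)"
  proof (rule sum.cong)
    fix j assume "j \<in> {..<n}"
    moreover have "cofactor (replace_row A i r) i j = cofactor A i j"
      using A by (intro cofactor_row_cong[of _ n]) (auto simp: replace_row_def)
    ultimately show "replace_row A i r $$ (i, j) * cofactor (replace_row A i r) i j = r j * cofactor A i j"
      using A i by (simp add: replace_row_def)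
  qed simp
  finally show ?thesis .
qed

text \<open>
  Differentiating the Leibniz formula row by row gives a sum of determinants in which one row has been differentiated;
  expand each of them along that row.
\<close>

lemma pderiv_det:
  fixes A :: "'a::idom poly mat"
  assumes A: "A \<in> carrier_mat n n"
  shows "pderiv (det A) = (\<Sum>i<n. \<Sum>j<n. pderiv (A $$ (i, j)) * cofactor A i j)"
proof -
  let ?S = "{\<pi>. \<pi> permutes {0..<n}}"
  let ?A = "\<lambda>i. replace_row A i (\<lambda>j. pderiv (A $$ (i, j)))"
  have "pderiv (det A) = (\<Sum>\<pi>\<in>?S. pderiv (of_int (sign \<pi>) * (\<Prod>i = 0..<n. A $$ (i, \<pi> i))))"
    by (simp add: det_def'[OF A] pderiv_sum)
  also have "\<dots> = (\<Sum>\<pi>\<in>?S. \<Sum>i = 0..<n. of_int (sign \<pi>) * (\<Prod>i' = 0..<n. ?A i $$ (i', \<pi> i')))"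
  proof (rule sum.cong)
    fix \<pi> assume "\<pi> \<in> ?S"
    then have \<pi>: "i < n \<Longrightarrow> \<pi> i < n" for i by (auto dest: permutes_in_image[of \<pi> _ i])
    have "(\<Prod>i' \<in> {0..<n} - {i}. A $$ (i', \<pi> i')) * pderiv (A $$ (i, \<pi> i)) = (\<Prod>i' = 0..<n. ?A i $$ (i', \<pi> i'))"
      if i: "i \<in> {0..<n}" for i
    proof -
      have "(\<Prod>i' = 0..<n. ?A i $$ (i', \<pi> i')) = ?A i $$ (i, \<pi> i) * (\<Prod>i' \<in> {0..<n} - {i}. ?A i $$ (i', \<pi> i'))"
        using i by (intro prod.remove) auto
      also have "(\<Prod>i' \<in> {0..<n} - {i}. ?A i $$ (i', \<pi> i')) = (\<Prod>i' \<in> {0..<n} - {i}. A $$ (i', \<pi> i'))"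
        using A \<pi> by (intro prod.cong) (auto simp: replace_row_def)
      finally show ?thesis using A \<pi> i by (simp add: replace_row_def mult.commute)
    qed
    moreover have "pderiv (of_int (sign \<pi>) * P) = of_int (sign \<pi>) * pderiv P" for P :: "'a poly"
      by (rule sign_cases[of \<pi>]) (simp_all add: pderiv_minus)
    ultimately show "pderiv (of_int (sign \<pi>) * (\<Prod>i = 0..<n. A $$ (i, \<pi> i))) =
        (\<Sum>i = 0..<n. of_int (sign \<pi>) * (\<Prod>i' = 0..<n. ?A i $$ (i', \<pi> i')))"
      by (simp add: pderiv_prod sum_distrib_left)
  qed simp
  also have "\<dots> = (\<Sum>i = 0..<n. \<Sum>\<pi>\<in>?S. of_int (sign \<pi>) * (\<Prod>i' = 0..<n. ?A i $$ (i', \<pi> i')))"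
    by (rule sum.swap)
  also have "\<dots> = (\<Sum>i = 0..<n. det (?A i))"
    by (simp add: det_def'[OF replace_row_carrier[OF A]])
  also have "\<dots> = (\<Sum>i<n. \<Sum>j<n. pderiv (A $$ (i, j)) * cofactor A i j)"
    by (simp add: det_replace_row[OF A] atLeast0LessThan)
  finally show ?thesis .
qed

lemma (in comm_ring_hom) hom_cofactor:
  assumes "A \<in> carrier_mat n n" "i < n" "j < n"
  shows "hom (cofactor A i j) = cofactor (map_mat hom A) i j"
proof -
  have "map_mat hom (mat_delete A i j) = mat_delete (map_mat hom A) i j"
    using assms by (intro eq_matI) (auto simp: mat_delete_def)
  then show ?thesis
    by (simp add: cofactor_def hom_mult hom_power hom_uminus flip: hom_det)
qed

definition labelled_mat :: "nat \<Rightarrow> (nat \<Rightarrow> nat \<Rightarrow> 'a) \<Rightarrow> 'a mat" where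
  "labelled_mat m e = mat m m (\<lambda>(i, j). e i j)"

lemma labelled_mat_carrier [simp]: "labelled_mat m e \<in> carrier_mat m m"
  by (simp add: labelled_mat_def)

lemma labelled_mat_index [simp]: "i < m \<Longrightarrow> j < m \<Longrightarrow> labelled_mat m e $$ (i, j) = e i j"
  by (simp add: labelled_mat_def)

lemma map_labelled_mat: "map_mat h (labelled_mat m e) = labelled_mat m (\<lambda>i j. h (e i j))"
  by (rule eq_matI) (auto simp: labelled_mat_def)

lemma gradient_det_labelled:
  fixes x :: "'v \<Rightarrow> 'k::field alg_closure"
  shows "mpoly_eval (pderiv_var v (det (labelled_mat m (\<lambda>i j. Var (e i j))))) x =
    (\<Sum>i<m. \<Sum>j<m. if e i j = v then cofactor (labelled_mat m (\<lambda>i j. x (e i j))) i j else 0)"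
proof -
  define l where "l = (\<lambda>w. if w = v then [:x v, 1:] else [:x w:])"
  let ?h = "mpoly_hom (\<lambda>c. [:to_ac c:]) l :: ('v, 'k) mpoly \<Rightarrow> _"
  let ?M = "labelled_mat m (\<lambda>i j. l (e i j))"
  have c: "comm_ring_hom (\<lambda>c :: 'k. [:to_ac c:])" by standard auto
  interpret h: comm_ring_hom ?h by (rule comm_ring_hom.comm_ring_hom_mpoly_hom[OF c])
  interpret p0: comm_ring_hom "\<lambda>q :: 'k alg_closure poly. poly q 0" by standard auto
  have "?h (det (labelled_mat m (\<lambda>i j. Var (e i j)))) = det ?M"
    by (simp add: map_labelled_mat comm_ring_hom.mpoly_hom_Var[OF c] flip: h.hom_det)
  then have "mpoly_eval (pderiv_var v (det (labelled_mat m (\<lambda>i j. Var (e i j))))) x = poly (pderiv (det ?M)) 0"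
    unfolding eval_pderiv_var l_def by simp
  also have "\<dots> = (\<Sum>i<m. \<Sum>j<m. poly (pderiv (?M $$ (i, j))) 0 * poly (cofactor ?M i j) 0)"
    by (simp add: pderiv_det[OF labelled_mat_carrier] poly_sum)
  also have "\<dots> = (\<Sum>i<m. \<Sum>j<m. if e i j = v then cofactor (labelled_mat m (\<lambda>i j. x (e i j))) i j else 0)"
  proof (intro sum.cong refl)
    fix i j assume ij: "i \<in> {..<m}" "j \<in> {..<m}"
    have "(\<lambda>i j. poly (l (e i j)) 0) = (\<lambda>i j. x (e i j))" by (auto simp: l_def fun_eq_iff)
    then have "poly (cofactor ?M i j) 0 = cofactor (labelled_mat m (\<lambda>i j. x (e i j))) i j"
      using ij p0.hom_cofactor[of ?M m i j] by (simp add: map_labelled_mat)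
    moreover have "poly (pderiv (?M $$ (i, j))) 0 = (if e i j = v then 1 else 0)"
      using ij by (auto simp: l_def pderiv_pCons)
    ultimately show "poly (pderiv (?M $$ (i, j))) 0 * poly (cofactor ?M i j) 0 =
        (if e i j = v then cofactor (labelled_mat m (\<lambda>i j. x (e i j))) i j else 0)" by simp
  qed
  finally show ?thesis .
qed

text \<open>
  The vector is encoded as a function because the same \<open>w\<close> also serves as an argument of a polynomial
  map.
\<close>

definition in_kernel :: "nat \<Rightarrow> 'a::comm_ring_1 mat \<Rightarrow> (nat \<Rightarrow> 'a) \<Rightarrow> bool" where
  "in_kernel n A w \<longleftrightarrow> (\<forall>i<n. (\<Sum>j<n. A $$ (i, j) * w j) = 0)"

lemma det_zero_iff_kernel:
  fixes A :: "'a::field mat"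
  assumes A: "A \<in> carrier_mat n n"
  shows "det A = 0 \<longleftrightarrow> (\<exists>w. in_kernel n A w \<and> (\<exists>i<n. w i \<noteq> 0))"
proof
  assume "det A = 0"
  then obtain v where v: "v \<in> carrier_vec n" "v \<noteq> 0\<^sub>v n" "A *\<^sub>v v = 0\<^sub>v n"
    using det_0_iff_vec_prod_zero[OF A] by blast
  have "\<exists>i<n. vec_index v i \<noteq> 0" using v(1,2) by (metis carrier_vecD eq_vecI index_zero_vec)
  moreover have "(\<Sum>j<n. A $$ (i, j) * vec_index v j) = 0" if "i < n" for i
    using arg_cong[OF v(3), of "\<lambda>u. vec_index u i"] that A v(1) by (simp add: scalar_prod_def atLeast0LessThan)
  ultimately show "\<exists>w. in_kernel n A w \<and> (\<exists>i<n. w i \<noteq> 0)"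
    unfolding in_kernel_def by (intro exI[of _ "vec_index v"]) auto
next
  assume "\<exists>w. in_kernel n A w \<and> (\<exists>i<n. w i \<noteq> 0)"
  then obtain w i where w: "in_kernel n A w" "i < n" "w i \<noteq> 0" by blast
  have "A *\<^sub>v vec n w = 0\<^sub>v n"
    using A w(1) by (intro eq_vecI) (auto simp: scalar_prod_def atLeast0LessThan in_kernel_def)
  moreover have "vec n w \<noteq> 0\<^sub>v n" using w(2,3) by (metis index_vec index_zero_vec(1))
  ultimately show "det A = 0" using det_0_iff_vec_prod_zero[OF A] vec_carrier by blast
qed

lemma cofactor_symmetric:
  fixes A :: "'a::comm_ring_1 mat"
  assumes A: "A \<in> carrier_mat n n" and sym: "\<And>i j. i < n \<Longrightarrow> j < n \<Longrightarrow> A $$ (i, j) = A $$ (j, i)"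
    and ij: "i < n" "j < n"
  shows "cofactor A i j = cofactor A j i"
proof -
  have "mat_delete A i j = transpose_mat (mat_delete A j i)"
    using A sym ij by (intro eq_matI) (auto simp: mat_delete_def)
  moreover have "mat_delete A j i \<in> carrier_mat (n - 1) (n - 1)" by (rule mat_delete_carrier[OF A])
  ultimately show ?thesis by (simp add: cofactor_def det_transpose add.commute)
qed

text \<open>
  If some cofactor is nonzero, the kernel is a line: let row \<open>a\<close> and column \<open>b\<close> be the
  position of a nonzero cofactor and replace row \<open>a\<close> by the unit vector at \<open>b\<close>. The result
  is invertible, so a kernel vector that vanishes at \<open>b\<close> is zero. The rows of the cofactor matrix lie in
  the kernel because the determinant is zero, so each of them is a multiple of \<open>z\<close>; by symmetry the same
  holds for the columns.
\<close>

lemma cofactor_symmetric_kernel: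
  fixes A :: "'a::field mat"
  assumes A: "A \<in> carrier_mat n n" and sym: "\<And>i j. i < n \<Longrightarrow> j < n \<Longrightarrow> A $$ (i, j) = A $$ (j, i)"
    and z: "in_kernel n A z" "\<exists>i<n. z i \<noteq> 0"
  shows "\<exists>\<mu>. \<forall>i<n. \<forall>j<n. cofactor A i j = \<mu> * (z i * z j)"
proof (cases "\<exists>a<n. \<exists>b<n. cofactor A a b \<noteq> 0")
  case False
  then show ?thesis by (intro exI[of _ 0]) auto
next
  case True
  then obtain a b where ab: "a < n" "b < n" "cofactor A a b \<noteq> 0" by blast
  \<comment> \<open>Expanding along the new row, the determinant of \<open>?B\<close> is the cofactor at \<open>(a, b)\<close>.\<close>
  let ?B = "replace_row A a (\<lambda>j. if j = b then 1 else 0)"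
  have "det ?B = cofactor A a b"
    using ab by (simp add: det_replace_row[OF A] if_distrib[of "\<lambda>t. t * _"] cong: if_cong)
  then have detB: "det ?B \<noteq> 0" using ab by simp
  have ker0: "w i = 0" if w: "in_kernel n A w" "w b = 0" and i: "i < n" for w i
  proof -
    have "(\<Sum>j<n. ?B $$ (i', j) * w j) = 0" if i': "i' < n" for i'
    proof (cases "i' = a")
      case True
      have "(\<Sum>j<n. ?B $$ (i', j) * w j) = (\<Sum>j<n. if j = b then w b else 0)"
        using A True ab by (intro sum.cong) (auto simp: replace_row_def)
      then show ?thesis using w(2) by simp
    next
      case False
      have "(\<Sum>j<n. ?B $$ (i', j) * w j) = (\<Sum>j<n. A $$ (i', j) * w j)"
        using A False i' by (intro sum.cong) (auto simp: replace_row_def)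
      then show ?thesis using w(1) i' by (simp add: in_kernel_def)
    qed
    then have "in_kernel n ?B w" by (simp add: in_kernel_def)
    then show ?thesis using detB i det_zero_iff_kernel[OF replace_row_carrier[OF A]] by blast
  qed
  then have zb: "z b \<noteq> 0" using z by blast
  have ker: "w i = w b / z b * z i" if w: "in_kernel n A w" and i: "i < n" for w i
  proof -
    let ?w = "\<lambda>i. w i - w b / z b * z i"
    have "(\<Sum>j<n. A $$ (i', j) * ?w j) = (\<Sum>j<n. A $$ (i', j) * w j) - w b / z b * (\<Sum>j<n. A $$ (i', j) * z j)" for i'
      by (simp add: right_diff_distrib sum_subtractf sum_distrib_left ac_simps)
    then have "in_kernel n A ?w" using w z(1) by (simp add: in_kernel_def)
    then show ?thesis using ker0[of ?w i] zb i by simp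
  qed
  have det0: "det A = 0" using z det_zero_iff_kernel[OF A] by blast
  have cof: "in_kernel n A (cofactor A k)" if k: "k < n" for k
    unfolding in_kernel_def
  proof (intro allI impI)
    fix i assume i: "i < n"
    have "(A * adj_mat A) $$ (i, k) = 0" using adj_mat(2)[OF A] det0 i k by simp
    then show "(\<Sum>j<n. A $$ (i, j) * cofactor A k j) = 0"
      using A i k by (simp add: adj_mat_def scalar_prod_def atLeast0LessThan)
  qed
  define lam where "lam k = cofactor A k b / z b" for k
  have c: "cofactor A k j = lam k * z j" if "k < n" "j < n" for k j
    using ker[OF cof[OF that(1)] that(2)] by (simp add: lam_def)
  have "lam k = lam b / z b * z k" if k: "k < n" for k
  proof -
    have "lam k * z b = lam b * z k"
      using c[OF k ab(2)] c[OF ab(2) k] cofactor_symmetric[OF A sym k ab(2)] by simp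
    then show ?thesis using zb by (simp add: field_simps)
  qed
  then have "cofactor A i j = lam b / z b * (z i * z j)" if "i < n" "j < n" for i j
    using c[OF that] that by simp
  then show ?thesis by blast
qed

section \<open>Tangent hyperplanes of a symmetric determinant\<close>

lemma proj_pt_mem_hyperplane:
  assumes "proj_pt y \<in> proj_space I"
  shows "proj_pt y \<in> hyperplane I (proj_pt a) \<longleftrightarrow> (\<Sum>v\<in>I. a v * y v) = 0"
proof -
  have scale: "(\<Sum>v\<in>I. c * a v * (c' * y v)) = c * c' * (\<Sum>v\<in>I. a v * y v)" for c c'
    by (simp add: sum_distrib_left ac_simps)
  show ?thesis
  proof
    assume "proj_pt y \<in> hyperplane I (proj_pt a)"
    then show "(\<Sum>v\<in>I. a v * y v) = 0"
      unfolding hyperplane_def using proj_pt_self by blast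
  next
    assume "(\<Sum>v\<in>I. a v * y v) = 0"
    then show "proj_pt y \<in> hyperplane I (proj_pt a)"
      using assms scale by (auto simp: hyperplane_def proj_pt_def)
  qed
qed

text \<open>
  If a linear form \<open>a\<close> vanishes wherever \<open>g\<close> does, then \<open>a\<close> is a multiple of
  \<open>g\<close>: test it on the vectors \<open>g\<^sub>w e\<^sub>v - g\<^sub>v e\<^sub>w\<close>.
\<close>

lemma hyperplane_subset_imp_eq:
  assumes I: "finite I" and g: "proj_pt g \<in> proj_space I" and H: "H \<in> proj_space I"
    and sub: "hyperplane I (proj_pt g) \<subseteq> hyperplane I H"
  shows "H = proj_pt g"
proof -
  obtain a where a: "H = proj_pt a" using H proj_space_nonempty by blast
  obtain w where w: "w \<in> I" "g w \<noteq> 0" using g unfolding proj_pt_in_proj_space by blast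
  have a0: "a v = 0" "g v = 0" if "v \<notin> I" for v
    using that H g unfolding a proj_pt_in_proj_space by auto
  have proportional: "a v * g w = a w * g v" if v: "v \<in> I" for v
  proof (cases "v = w")
    case False
    define y where "y i = (if i = v then g w else 0) - (if i = w then g v else 0)" for i
    have sum: "(\<Sum>i\<in>I. h i * y i) = h v * g w - h w * g v" for h
      using I v w(1) by (simp add: y_def right_diff_distrib sum_subtractf if_distrib[of "\<lambda>t. _ * t"] cong: if_cong)
    have y: "proj_pt y \<in> proj_space I"
      unfolding proj_pt_in_proj_space using v w False by (auto simp: y_def intro!: bexI[of _ v])
    have "proj_pt y \<in> hyperplane I (proj_pt g)"
      unfolding proj_pt_mem_hyperplane[OF y] sum by simp
    then have "proj_pt y \<in> hyperplane I (proj_pt a)" using sub a by blast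
    then show ?thesis unfolding proj_pt_mem_hyperplane[OF y] sum by simp
  qed simp
  have eq: "a = (\<lambda>v. a w / g w * g v)"
  proof
    fix v show "a v = a w / g w * g v"
      using proportional[of v] a0[of v] w(2) by (cases "v \<in> I") (auto simp: field_simps)
  qed
  have "a w \<noteq> 0"
  proof
    assume "a w = 0"
    then have "a v = 0" for v using fun_cong[OF eq, of v] by simp
    then show False using H unfolding a proj_pt_in_proj_space by simp
  qed
  then have "a w / g w \<noteq> 0" using w(2) by simp
  then have "proj_pt (\<lambda>v. a w / g w * g v) = proj_pt g" by (rule proj_pt_scale)
  then show ?thesis using a eq by simp
qed

text \<open>
  For the generic symmetric matrix this is the quadratic Veronese map, up to a factor \<open>2\<close> at the mixed
  coordinates. In general, coordinates whose positions carry the same label are added.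
\<close>

definition sym_square :: "nat \<Rightarrow> (nat \<Rightarrow> nat \<Rightarrow> 'v) \<Rightarrow> 'v \<Rightarrow> (nat, 'k::field) mpoly" where
  "sym_square m e v = (\<Sum>i<m. \<Sum>j<m. if e i j = v then Var i * Var j else 0)"

lemma sym_square_homog: "sym_square m e v \<in> homog {..<m} 2"
proof -
  have "Var i * Var j \<in> homog {..<m} (1 + 1)" if "i < m" "j < m" for i j
    using that by (intro homog_mult homog_Var) auto
  then show ?thesis
    unfolding sym_square_def by (intro homog_sum) (auto simp: numeral_2_eq_2)
qed

lemma poly_map_sym_square:
  "poly_map (sym_square m e) u v = (\<Sum>i<m. \<Sum>j<m. if e i j = v then u i * u j else 0)"
  unfolding poly_map_def sym_square_def ev.hom_sum
  by (intro sum.cong refl) (simp add: ev.hom_mult)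

lemma poly_map_sym_square_filter:
  "poly_map (sym_square m e) u v = (\<Sum>(i, j)\<in>{(i, j). i < m \<and> j < m \<and> e i j = v}. u i * u j)"
proof -
  have "{(i, j). i < m \<and> j < m \<and> e i j = v} = {ij \<in> {..<m} \<times> {..<m}. e (fst ij) (snd ij) = v}" by auto
  moreover have "poly_map (sym_square m e) u v =
      (\<Sum>ij\<in>{..<m} \<times> {..<m}. if e (fst ij) (snd ij) = v then u (fst ij) * u (snd ij) else 0)"
    by (simp add: poly_map_sym_square sum.cartesian_product case_prod_beta)
  ultimately show ?thesis by (simp add: sum.inter_filter case_prod_beta)
qed

text \<open>
  The gradient of the determinant is the transpose of the linear map \<open>x \<mapsto> M(x)\<close>, applied to the
  matrix of cofactors, which is \<open>\<mu> z z\<^sup>T\<close>.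
\<close>

lemma gradient_at_kernel:
  fixes e :: "nat \<Rightarrow> nat \<Rightarrow> 'v" and x :: "'v \<Rightarrow> 'k::field alg_closure"
  assumes sym: "\<And>i j. e i j = e j i"
    and z: "in_kernel m (labelled_mat m (\<lambda>i j. x (e i j))) z" "\<exists>i<m. z i \<noteq> 0"
  shows "\<exists>\<mu>. (\<forall>i<m. \<forall>j<m. cofactor (labelled_mat m (\<lambda>i j. x (e i j))) i j = \<mu> * (z i * z j)) \<and>
    (\<forall>v. mpoly_eval (pderiv_var v (det (labelled_mat m (\<lambda>i j. Var (e i j))))) x = \<mu> * poly_map (sym_square m e) z v)"
proof -
  let ?M = "labelled_mat m (\<lambda>i j. x (e i j))"
  have "?M $$ (i, j) = ?M $$ (j, i)" if "i < m" "j < m" for i j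
    using that sym by simp
  then obtain \<mu> where \<mu>: "\<forall>i<m. \<forall>j<m. cofactor ?M i j = \<mu> * (z i * z j)"
    using cofactor_symmetric_kernel[OF labelled_mat_carrier _ z] by blast
  have "mpoly_eval (pderiv_var v (det (labelled_mat m (\<lambda>i j. Var (e i j))))) x = \<mu> * poly_map (sym_square m e) z v" for v
    unfolding gradient_det_labelled poly_map_sym_square sum_distrib_left
    by (intro sum.cong refl) (simp add: \<mu>)
  then show ?thesis using \<mu> by blast
qed

lemma eval_det_labelled:
  "mpoly_eval (det (labelled_mat m (\<lambda>i j. Var (e i j)))) x = det (labelled_mat m (\<lambda>i j. x (e i j)))"
  by (simp add: map_labelled_mat flip: ev.hom_det)

lemma in_kernel_scale:
  assumes "in_kernel m (labelled_mat m a) z"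
  shows "in_kernel m (labelled_mat m (\<lambda>i j. c * a i j)) z"
proof -
  have "(\<Sum>j<m. labelled_mat m (\<lambda>i j. c * a i j) $$ (i, j) * z j) =
      c * (\<Sum>j<m. labelled_mat m a $$ (i, j) * z j)" if "i < m" for i
    using that by (simp add: sum_distrib_left ac_simps)
  then show ?thesis using assms by (simp add: in_kernel_def)
qed

lemma tangent_space_at_kernel:
  fixes e :: "nat \<Rightarrow> nat \<Rightarrow> 'v" and x :: "'v \<Rightarrow> 'k::field alg_closure" and m :: nat
  defines "f \<equiv> det (labelled_mat m (\<lambda>i j. Var (e i j))) :: ('v, 'k) mpoly"
  assumes sym: "\<And>i j. e i j = e j i"
    and P: "proj_pt x \<in> smooth_points I f"
    and z: "in_kernel m (labelled_mat m (\<lambda>i j. x (e i j))) z" "\<exists>i<m. z i \<noteq> 0"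
  shows "tangent_space I f (proj_pt x) = hyperplane I (proj_pt (poly_map (sym_square m e) z))"
    and "\<exists>v\<in>I. poly_map (sym_square m e) z v \<noteq> 0"
proof -
  let ?\<phi> = "poly_map (sym_square m e) z"
  have grad: "\<exists>\<mu>. \<mu> \<noteq> 0 \<and> (\<forall>v. mpoly_eval (pderiv_var v f) x' = \<mu> * ?\<phi> v) \<and> (\<exists>v\<in>I. ?\<phi> v \<noteq> 0)"
    if x': "x' \<in> proj_pt x" for x'
  proof -
    obtain c where c: "x' = (\<lambda>v. c * x v)" using x' by (auto simp: proj_pt_def)
    have "in_kernel m (labelled_mat m (\<lambda>i j. x' (e i j))) z"
      unfolding c by (rule in_kernel_scale[OF z(1)])
    then obtain \<mu> where \<mu>: "\<And>v. mpoly_eval (pderiv_var v f) x' = \<mu> * ?\<phi> v"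
      unfolding f_def using gradient_at_kernel[of e m x' z, OF sym _ z(2)] by blast
    moreover have "\<exists>v\<in>I. mpoly_eval (pderiv_var v f) x' \<noteq> 0"
      using P x' by (auto simp: smooth_points_def)
    ultimately show ?thesis by (intro exI[of _ \<mu>]) auto
  qed
  show "\<exists>v\<in>I. ?\<phi> v \<noteq> 0" using grad[OF proj_pt_self] by blast
  have lin: "(\<Sum>v\<in>I. mpoly_eval (pderiv_var v f) x' * y v) = 0 \<longleftrightarrow> (\<Sum>v\<in>I. ?\<phi> v * y v) = 0"
    if x': "x' \<in> proj_pt x" for x' y
  proof -
    obtain \<mu> where \<mu>: "\<mu> \<noteq> 0" "\<forall>v. mpoly_eval (pderiv_var v f) x' = \<mu> * ?\<phi> v"
      using grad[OF x'] by blast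
    then have "(\<Sum>v\<in>I. mpoly_eval (pderiv_var v f) x' * y v) = \<mu> * (\<Sum>v\<in>I. ?\<phi> v * y v)"
      by (simp add: sum_distrib_left mult.assoc)
    then show ?thesis using \<mu>(1) by simp
  qed
  show "tangent_space I f (proj_pt x) = hyperplane I (proj_pt ?\<phi>)"
  proof (rule Set.set_eqI)
    fix Q
    show "Q \<in> tangent_space I f (proj_pt x) \<longleftrightarrow> Q \<in> hyperplane I (proj_pt ?\<phi>)"
    proof (cases "Q \<in> proj_space I")
      case True
      then obtain y where y: "Q = proj_pt y" using proj_space_nonempty by blast
      have "Q \<in> tangent_space I f (proj_pt x) \<longleftrightarrow> (\<forall>y'\<in>Q. (\<Sum>v\<in>I. ?\<phi> v * y' v) = 0)"
        using True lin proj_pt_self[of x] by (auto simp: tangent_space_def)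
      also have "\<dots> \<longleftrightarrow> (\<forall>c. c \<noteq> 0 \<longrightarrow> c * (\<Sum>v\<in>I. ?\<phi> v * y v) = 0)"
        by (auto simp: y proj_pt_def sum_distrib_left ac_simps)
      also have "\<dots> \<longleftrightarrow> (\<Sum>v\<in>I. ?\<phi> v * y v) = 0" by (auto dest: spec[of _ 1])
      also have "\<dots> \<longleftrightarrow> Q \<in> hyperplane I (proj_pt ?\<phi>)"
        using True unfolding y by (simp add: proj_pt_mem_hyperplane)
      finally show ?thesis .
    qed (auto simp: tangent_space_def hyperplane_def)
  qed
qed

text \<open>
  The dual variety is the closure of this set.
\<close>

definition tangent_hyperplanes :: "'v set \<Rightarrow> ('v, 'k::field) mpoly \<Rightarrow> ('v, 'k) proj_point set" where
  "tangent_hyperplanes I f =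
     {H \<in> proj_space I. \<exists>P\<in>smooth_points I f. tangent_space I f P \<subseteq> hyperplane I H}"

text \<open>
  A point of the hypersurface is a singular matrix, which has a kernel vector, and at a smooth point that vector
  determines the tangent hyperplane.
\<close>

lemma tangent_hyperplanes_det_subset:
  fixes e :: "nat \<Rightarrow> nat \<Rightarrow> 'v" and m :: nat
  defines "I \<equiv> {e i j | i j. i < m \<and> j < m}"
  assumes sym: "\<And>i j. e i j = e j i"
  shows "tangent_hyperplanes I (det (labelled_mat m (\<lambda>i j. Var (e i j))) :: ('v, 'k::field) mpoly)
    \<subseteq> image_pts I (sym_square m e) UNIV"
proof
  let ?f = "det (labelled_mat m (\<lambda>i j. Var (e i j))) :: ('v, 'k) mpoly"
  have I: "finite I"
  proof -
    have "I = (\<lambda>(i, j). e i j) ` ({..<m} \<times> {..<m})" by (auto simp: I_def)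
    then show ?thesis by simp
  qed
  fix H assume "H \<in> tangent_hyperplanes I ?f"
  then obtain P where H: "H \<in> proj_space I" and P: "P \<in> smooth_points I ?f"
    and sub: "tangent_space I ?f P \<subseteq> hyperplane I H"
    by (auto simp: tangent_hyperplanes_def)
  have hyp: "P \<in> hypersurface I ?f" "P \<in> proj_space I"
    using P by (auto simp: smooth_points_def hypersurface_def)
  obtain x where x: "P = proj_pt x" using hyp(2) proj_space_nonempty by blast
  have "mpoly_eval ?f x = 0" using hyp(1) proj_pt_self[of x] by (auto simp: hypersurface_def x)
  then have "det (labelled_mat m (\<lambda>i j. x (e i j))) = 0" by (simp add: eval_det_labelled)
  then obtain z where z: "in_kernel m (labelled_mat m (\<lambda>i j. x (e i j))) z" "\<exists>i<m. z i \<noteq> 0"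
    using det_zero_iff_kernel[OF labelled_mat_carrier] by blast
  let ?\<phi> = "poly_map (sym_square m e) z :: 'v \<Rightarrow> 'k alg_closure"
  note tan = tangent_space_at_kernel[of e x I m z, OF sym P[unfolded x] z]
  have "?\<phi> v = 0" if "v \<notin> I" for v
    unfolding poly_map_sym_square using that by (intro sum.neutral ballI) (auto simp: I_def)
  then have \<phi>: "proj_pt ?\<phi> \<in> proj_space I"
    unfolding proj_pt_in_proj_space using tan(2) by blast
  have "H = proj_pt ?\<phi>"
    by (rule hyperplane_subset_imp_eq[OF I \<phi> H]) (use sub tan(1) x in simp)
  then show "H \<in> image_pts I (sym_square m e) UNIV" using H by (auto simp: image_pts_def)
qed

section \<open>Cloning along the main diagonal\<close>

text \<open>
  A symmetric matrix with kernel vector \<open>u\<close>: it agrees with the identity off row and column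
  \<open>c\<close>, and the remaining entries are then forced. It is the sum over \<open>k \<noteq> c\<close> of the
  squares of the linear forms \<open>x\<^sub>k - (u\<^sub>k / u\<^sub>c) x\<^sub>c\<close>. Its diagonal entries other
  than the one at \<open>c\<close> are all equal to \<open>1\<close>, so it survives the cloning.
\<close>

definition star :: "nat \<Rightarrow> (nat \<Rightarrow> 'a::field) \<Rightarrow> nat \<Rightarrow> nat \<Rightarrow> nat \<Rightarrow> 'a" where
  "star m u c i j =
     (if i = c \<and> j = c then \<Sum>k\<in>{..<m} - {c}. (u k / u c)\<^sup>2
      else if i = c then - (u j / u c)
      else if j = c then - (u i / u c)
      else if i = j then 1 else 0)"

lemma star_sym: "star m u c i j = star m u c j i"
  by (simp add: star_def)

lemma star_kernel:
  assumes c: "c < m" "u c \<noteq> 0"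
  shows "in_kernel m (labelled_mat m (star m u c)) u"
  unfolding in_kernel_def
proof (intro allI impI)
  fix i assume i: "i < m"
  have "(\<Sum>j<m. labelled_mat m (star m u c) $$ (i, j) * u j) = (\<Sum>j<m. star m u c i j * u j)"
    using i by simp
  also have "\<dots> = star m u c i c * u c + (\<Sum>j\<in>{..<m} - {c}. star m u c i j * u j)"
    using c(1) by (intro sum.remove) auto
  also have "\<dots> = 0"
  proof (cases "i = c")
    case True
    have "star m u c i c * u c = (\<Sum>j\<in>{..<m} - {c}. u j / u c * u j)"
      using True c(2) by (simp add: star_def sum_distrib_right power2_eq_square)
    moreover have "(\<Sum>j\<in>{..<m} - {c}. star m u c i j * u j) = (\<Sum>j\<in>{..<m} - {c}. - (u j / u c * u j))"
      using True by (intro sum.cong) (auto simp: star_def)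
    ultimately show ?thesis by (simp add: sum_negf)
  next
    case False
    have "(\<Sum>j\<in>{..<m} - {c}. star m u c i j * u j) = (\<Sum>j\<in>{..<m} - {c}. if j = i then u i else 0)"
      using False by (intro sum.cong) (auto simp: star_def)
    also have "\<dots> = u i" using i False by simp
    finally show ?thesis using False c(2) by (simp add: star_def)
  qed
  finally show "(\<Sum>j<m. labelled_mat m (star m u c) $$ (i, j) * u j) = 0" .
qed

text \<open>
  The factor \<open>s\<close> accounts for the choice of a representative of the projective point.
\<close>

lemma star_cofactor:
  assumes c: "c < m"
  shows "cofactor (labelled_mat m (\<lambda>i j. s * star m u c i j)) c c = s ^ (m - 1)"
proof -
  have "mat_delete (labelled_mat m (\<lambda>i j. s * star m u c i j)) c c = s \<cdot>\<^sub>m 1\<^sub>m (m - 1)"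
    using c by (intro eq_matI) (auto simp: mat_delete_def labelled_mat_def star_def)
  moreover have "(- 1 :: 'a) ^ (c + c) = 1" by simp
  ultimately show ?thesis by (simp only: cofactor_def) simp
qed

definition md_label :: "nat \<Rightarrow> nat \<Rightarrow> nat \<Rightarrow> nat \<Rightarrow> nat \<times> nat" where
  "md_label p q i j = (if i = p \<and> j = p then (q, q) else (min i j, max i j))"

lemma md_label_sym: "md_label p q i j = md_label p q j i"
  by (auto simp: md_label_def min.commute max.commute)

lemma md_cloning_labelled:
  fixes SC :: "(nat \<times> nat, 'k::field) mpoly mat"
  assumes "md_cloning m SC"
  obtains p q where "p < m" "q < m" "p \<noteq> q" "SC = labelled_mat m (\<lambda>i j. Var (md_label p q i j))"
proof -
  obtain p q where pq: "p < m" "q < m" "p \<noteq> q"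
    and SC: "SC = map_mat (mpoly_hom Const (Var((p, p) := Var (q, q)))) (generic_symmetric m)"
    using assms by (auto simp: md_cloning_def)
  have "SC = labelled_mat m (\<lambda>i j. Var (md_label p q i j))"
    unfolding SC generic_symmetric_def labelled_mat_def
    by (rule eq_matI)
      (auto simp: comm_ring_hom.mpoly_hom_Var[OF comm_ring_hom_Const] md_label_def min_def max_def
        split: if_splits)
  then show thesis using that pq by blast
qed

lemma Var_eq_iff: "(Var v :: ('v, 'k::field) mpoly) = Var w \<longleftrightarrow> v = w"
proof
  assume "(Var v :: ('v, 'k) mpoly) = Var w"
  then have "Poly_Mapping.keys (Var v :: ('v, 'k) mpoly) = Poly_Mapping.keys (Var w :: ('v, 'k) mpoly)" by simp
  then have "Poly_Mapping.single v (1 :: nat) = Poly_Mapping.single w 1" by (simp add: Var_def)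
  then have "Poly_Mapping.keys (Poly_Mapping.single v (1 :: nat)) = Poly_Mapping.keys (Poly_Mapping.single w (1 :: nat))" by simp
  then show "v = w" by simp
qed simp

lemma entry_vars_labelled:
  "entry_vars (labelled_mat m (\<lambda>i j. Var (e i j)) :: ('v, 'k::field) mpoly mat) = {e i j | i j. i < m \<and> j < m}"
proof -
  have "elements_mat (labelled_mat m (\<lambda>i j. Var (e i j)) :: ('v, 'k) mpoly mat) = {Var (e i j) | i j. i < m \<and> j < m}"
    by (auto simp: elements_mat_def labelled_mat_def) blast
  then show ?thesis by (auto simp: entry_vars_def Var_eq_iff)
qed

text \<open>
  The matrix \<open>star m u c\<close> lies in the family because its diagonal entries at \<open>p\<close> and
  \<open>q\<close> agree. Its cofactor at \<open>(c, c)\<close> is nonzero, so the gradient there is a nonzero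
  multiple of \<open>\<phi>(u)\<close>.
\<close>

lemma tangent_hyperplanes_md_superset:
  fixes p q m :: nat and f :: "(nat \<times> nat, 'k::field_char_0) mpoly"
  defines "e \<equiv> md_label p q"
  defines "I \<equiv> {e i j | i j. i < m \<and> j < m}"
  defines "f \<equiv> det (labelled_mat m (\<lambda>i j. Var (e i j)))"
  assumes pq: "p < m" "q < m" and c: "c < m" "c \<noteq> p" "c \<noteq> q"
    and u: "u c \<noteq> 0" and H: "proj_pt (poly_map (sym_square m e) u) \<in> proj_space I"
  shows "proj_pt (poly_map (sym_square m e) u) \<in> tangent_hyperplanes I f"
proof -
  let ?\<phi> = "poly_map (sym_square m e) u :: nat \<times> nat \<Rightarrow> 'k alg_closure"
  have sym: "e i j = e j i" for i j unfolding e_def by (rule md_label_sym)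
  define x where "x v = (if v \<in> I then star m u c (fst v) (snd v) else 0)" for v
  have xe: "x (e i j) = star m u c i j" if "i < m" "j < m" for i j
  proof -
    have eI: "e i j \<in> I" using that by (auto simp: I_def)
    show ?thesis
    proof (cases "i = p \<and> j = p")
      case True
      then show ?thesis using c eI by (simp add: x_def e_def md_label_def star_def)
    next
      case False
      then have "x (e i j) = star m u c (min i j) (max i j)"
        using eI by (auto simp: x_def e_def md_label_def)
      then show ?thesis using star_sym[of m u c i j] by (auto simp: min_def max_def)
    qed
  qed
  have Mx: "labelled_mat m (\<lambda>i j. s * x (e i j)) = labelled_mat m (\<lambda>i j. s * star m u c i j)" for s
    by (rule eq_matI) (auto simp: labelled_mat_def xe)
  have ker: "in_kernel m (labelled_mat m (\<lambda>i j. s * x (e i j))) u" for s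
    unfolding Mx by (rule in_kernel_scale[OF star_kernel[of c m u, OF c(1) u]])
  have u': "\<exists>i<m. u i \<noteq> 0" using c(1) u by blast
  have "e q q \<in> I" "x (e q q) = 1"
    using pq(2) xe[of q q] c by (auto simp: I_def star_def)
  then have x: "proj_pt x \<in> proj_space I"
    unfolding proj_pt_in_proj_space by (auto simp: x_def intro!: bexI[of _ "e q q"])
  have "mpoly_eval f x' = 0 \<and> (\<exists>v\<in>I. mpoly_eval (pderiv_var v f) x' \<noteq> 0)" if x': "x' \<in> proj_pt x" for x'
  proof -
    obtain s where s: "x' = (\<lambda>v. s * x v)" "s \<noteq> 0" using x' by (auto simp: proj_pt_def)
    have ker': "in_kernel m (labelled_mat m (\<lambda>i j. x' (e i j))) u" unfolding s(1) by (rule ker)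
    then have "mpoly_eval f x' = 0"
      unfolding f_def eval_det_labelled using det_zero_iff_kernel[OF labelled_mat_carrier] u' by blast
    obtain \<mu> where \<mu>: "\<forall>i<m. \<forall>j<m. cofactor (labelled_mat m (\<lambda>i j. x' (e i j))) i j = \<mu> * (u i * u j)"
      "\<forall>v. mpoly_eval (pderiv_var v f) x' = \<mu> * ?\<phi> v"
      using gradient_at_kernel[of e m x' u, OF sym ker' u'] unfolding f_def by blast
    have "\<mu> * (u c * u c) = s ^ (m - 1)"
      using \<mu>(1) c(1) star_cofactor[OF c(1), of s u] Mx[of s] by (simp add: s(1))
    then have "\<mu> \<noteq> 0" using s(2) by auto
    moreover obtain v where "v \<in> I" "?\<phi> v \<noteq> 0" using H unfolding proj_pt_in_proj_space by blast
    ultimately show ?thesis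
      using \<open>mpoly_eval f x' = 0\<close> by (intro conjI bexI[of _ v]) (simp_all add: \<mu>(2))
  qed
  then have P: "proj_pt x \<in> smooth_points I f"
    using x by (auto simp: smooth_points_def hypersurface_def)
  have ker1: "in_kernel m (labelled_mat m (\<lambda>i j. x (e i j))) u" using ker[of 1] by simp
  have "tangent_space I f (proj_pt x) = hyperplane I (proj_pt ?\<phi>)"
    unfolding f_def by (rule tangent_space_at_kernel(1)[of e x I m u, OF sym P[unfolded f_def] ker1 u'])
  then show ?thesis using H P by (auto simp: tangent_hyperplanes_def)
qed

text \<open>
  The three kinds of coordinates that are needed: the cloned one shows that the image of the smallest subspace in the
  chain is not empty, the one at \<open>(c, c)\<close> cuts out a dense set of tangent hyperplanes, and the mixed ones
  separate the members of the chain.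
\<close>

lemma sym_square_md_values:
  assumes "p < m" "q < m" "p \<noteq> q"
  shows "poly_map (sym_square m (md_label p q)) u (q, q) = u p * u p + u q * u q"
    and "c < m \<Longrightarrow> c \<noteq> p \<Longrightarrow> c \<noteq> q \<Longrightarrow> poly_map (sym_square m (md_label p q)) u (c, c) = u c * u c"
    and "r < m \<Longrightarrow> r \<noteq> p \<Longrightarrow> poly_map (sym_square m (md_label p q)) u (md_label p q p r) = 2 * u p * u r"
proof -
  have "{(i, j). i < m \<and> j < m \<and> md_label p q i j = (q, q)} = {(p, p), (q, q)}"
    using assms by (auto simp: md_label_def min_def max_def split: if_splits)
  then show "poly_map (sym_square m (md_label p q)) u (q, q) = u p * u p + u q * u q"
    using assms by (simp add: poly_map_sym_square_filter)
next
  assume "c < m" "c \<noteq> p" "c \<noteq> q"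
  then have "{(i, j). i < m \<and> j < m \<and> md_label p q i j = (c, c)} = {(c, c)}"
    by (auto simp: md_label_def min_def max_def split: if_splits)
  then show "poly_map (sym_square m (md_label p q)) u (c, c) = u c * u c"
    by (simp add: poly_map_sym_square_filter)
next
  assume r: "r < m" "r \<noteq> p"
  then have "{(i, j). i < m \<and> j < m \<and> md_label p q i j = md_label p q p r} = {(p, r), (r, p)}"
    using assms by (auto simp: md_label_def min_def max_def split: if_splits)
  then show "poly_map (sym_square m (md_label p q)) u (md_label p q p r) = 2 * u p * u r"
    using r by (simp add: poly_map_sym_square_filter)
qed

theorem theorem4p4:
  fixes m :: nat
    and SC :: "(nat \<times> nat, 'k::field_char_0) mpoly mat"
    and f :: "(nat \<times> nat, 'k) mpoly"
  assumes "m \<ge> 3"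
    and "md_cloning m SC"
    and "f = det SC"
  shows "variety_dim (entry_vars SC) (dual_variety (entry_vars SC) f) = enat (m - 1)"
proof -
  obtain p q where pq: "p < m" "q < m" "p \<noteq> q" and SC: "SC = labelled_mat m (\<lambda>i j. Var (md_label p q i j))"
    using assms(2) by (rule md_cloning_labelled)
  define e where "e = md_label p q"
  define I where "I = {e i j | i j. i < m \<and> j < m}"
  define \<phi> where "\<phi> = (sym_square m e :: nat \<times> nat \<Rightarrow> (nat, 'k) mpoly)"
  let ?T = "tangent_hyperplanes I f"
  have I: "entry_vars SC = I" unfolding SC I_def e_def by (rule entry_vars_labelled)
  have f: "f = det (labelled_mat m (\<lambda>i j. Var (e i j)))" by (simp add: assms(3) SC e_def)
  have dual: "dual_variety I f = zariski_closure I ?T"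
    by (simp add: dual_variety_def tangent_hyperplanes_def)
  have T_sub: "?T \<subseteq> image_pts I \<phi> UNIV"
    unfolding f I_def \<phi>_def by (rule tangent_hyperplanes_det_subset) (simp add: e_def md_label_sym)
  have supp: "\<phi> v = 0" if "v \<notin> I" for v
    unfolding \<phi>_def sym_square_def using that by (intro sum.neutral ballI) (auto simp: I_def)
  have in_I: "e i j \<in> I" if "i < m" "j < m" for i j using that by (auto simp: I_def)
  have qq: "(q, q) \<in> I" using in_I[OF pq(2,2)] pq by (simp add: e_def md_label_def)
  have val_q: "poly_map \<phi> u (q, q) = u p * u p + u q * u q" for u
    unfolding \<phi>_def e_def by (rule sym_square_md_values(1)[OF pq])
  have val_c: "poly_map \<phi> u (c, c) = u c * u c" if "c < m" "c \<noteq> p" "c \<noteq> q" for c u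
    unfolding \<phi>_def e_def by (rule sym_square_md_values(2)[OF pq that])
  have val_r: "poly_map \<phi> u (e p r) = 2 * u p * u r" if "r < m" "r \<noteq> p" for r u
    unfolding \<phi>_def e_def by (rule sym_square_md_values(3)[OF pq that])
  have pt: "proj_pt (poly_map \<phi> u) \<in> proj_space I" if "v \<in> I" "poly_map \<phi> u v \<noteq> 0" for u v
    unfolding proj_pt_in_proj_space using that supp by (auto simp: poly_map_def ev.hom_zero)

  have le: "variety_dim I (dual_variety I f) \<le> enat (m - 1)"
    unfolding dual by (rule variety_dim_closure_le[OF T_sub, of m 2]) (simp_all add: \<phi>_def sym_square_homog)

  have "card {p, q} < card {..<m}" using assms(1) by (simp add: card_insert_if)
  then have "\<not> {..<m} \<subseteq> {p, q}" using card_mono[of "{p, q}" "{..<m}"] by auto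
  then obtain c where c: "c < m" "c \<noteq> p" "c \<noteq> q" by auto
  have cc: "(c, c) \<in> I" using in_I[OF c(1,1)] c by (simp add: e_def md_label_def)
  let ?h = "Var (c, c) :: (nat \<times> nat, 'k) mpoly"
  have h: "?h \<in> forms I" using homog_Var[OF cc] forms_iff_homog by blast
  have dense: "image_pts I \<phi> UNIV \<subseteq> dual_variety I f"
    unfolding dual
  proof (rule image_pts_dense[OF supp h])
    let ?u = "\<lambda>i. if i = c then 1 else 0 :: 'k alg_closure"
    have nz: "poly_map \<phi> ?u (c, c) \<noteq> 0" by (simp add: val_c[OF c])
    have P: "proj_pt (poly_map \<phi> ?u) \<in> proj_space I" using pt[OF cc nz] .
    have "proj_pt (poly_map \<phi> ?u) \<notin> hypersurface I ?h"
      using mem_hypersurface_iff[OF h P proj_pt_self] nz by simp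
    then show "\<not> image_pts I \<phi> UNIV \<subseteq> hypersurface I ?h" using P by (auto simp: image_pts_def)
  next
    show "image_pts I \<phi> UNIV - hypersurface I ?h \<subseteq> ?T"
    proof
      fix H assume H: "H \<in> image_pts I \<phi> UNIV - hypersurface I ?h"
      then obtain u where u: "H = proj_pt (poly_map \<phi> u)" "H \<in> proj_space I" by (auto simp: image_pts_def)
      then have "poly_map \<phi> u (c, c) \<noteq> 0"
        using H mem_hypersurface_iff[OF h u(2), of "poly_map \<phi> u"] proj_pt_self[of "poly_map \<phi> u"] by simp
      then have "u c \<noteq> 0" by (auto simp: val_c[OF c])
      then show "H \<in> ?T"
        using tangent_hyperplanes_md_superset[OF pq(1,2) c, of u] u
        unfolding u(1) f \<phi>_def I_def e_def by blast
    qed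
  qed (auto simp: tangent_hyperplanes_def)

  \<comment> \<open>The chain of coordinate subspaces must start at \<open>p\<close>, since all separating coordinates involve \<open>u\<^sub>p\<close>; the transposition \<open>\<sigma>\<close> enumerates the indices in such an order.\<close>
  define \<sigma> where "\<sigma> = Transposition.transpose 0 p"
  have \<sigma>: "\<sigma> 0 = p" "inj \<sigma>" "\<And>i. i < m \<Longrightarrow> \<sigma> i < m"
    using pq(1) by (auto simp: \<sigma>_def Transposition.transpose_def inj_on_def split: if_splits)
  define L where "L i = {u :: nat \<Rightarrow> 'k alg_closure. \<forall>j. j \<notin> \<sigma> ` {..i} \<longrightarrow> u j = 0}" for i
  let ?u = "\<lambda>i. if i = p then 1 else 0 :: 'k alg_closure"
  have ge: "variety_dim I (dual_variety I f) \<ge> enat (m - 1)"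
  proof (rule variety_dim_closure_ge[OF _ dense supp, where L = L])
    show "closedin (zariski I) (dual_variety I f)" unfolding dual by (rule closedin_closure_of)
    show "L i \<subseteq> L (Suc i)" for i by (auto simp: L_def atMost_Suc)
    have "?u \<in> L 0" by (auto simp: L_def \<sigma>(1))
    moreover have "poly_map \<phi> ?u (q, q) \<noteq> 0" using pq(3) by (simp add: val_q)
    ultimately show "image_pts I \<phi> (L 0) \<noteq> {}"
      using pt[OF qq, of ?u] unfolding image_pts_def by blast
    show "\<exists>v\<in>I. (\<forall>u\<in>L i. poly_map \<phi> u v = 0) \<and> (\<exists>u\<in>L (Suc i). poly_map \<phi> u v \<noteq> 0)"
      if i: "i < m - 1" for i
    proof -
      define r where "r = \<sigma> (Suc i)"
      have r: "r < m" "r \<noteq> p" "r \<notin> \<sigma> ` {..i}"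
        using \<sigma> i by (auto simp: r_def inj_eq image_iff)
      let ?w = "\<lambda>i. if i = p \<or> i = r then 1 else 0 :: 'k alg_closure"
      have "p \<in> \<sigma> ` {..Suc i}" "r \<in> \<sigma> ` {..Suc i}"
        using \<sigma>(1) by (auto simp: r_def image_iff intro: bexI[of _ 0])
      then have "?w \<in> L (Suc i)" by (auto simp: L_def)
      moreover have "poly_map \<phi> ?w (e p r) \<noteq> 0" by (simp add: val_r[OF r(1,2)])
      moreover have "poly_map \<phi> u (e p r) = 0" if "u \<in> L i" for u
        using that r(3) by (simp add: val_r[OF r(1,2)] L_def)
      ultimately show ?thesis using in_I[OF pq(1) r(1)] by blast
    qed
  qed (auto simp: L_def)
  show ?thesis unfolding I using le ge by (rule antisym)
qed

end
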